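(* Let $i\ge 11$ be an integer and write $\dfrac{(q;q)_\infty^9}{(q^3;q^3)_\infty^i}=\sum_{n\ge0}a_nq^n$. Then for all $n\ge0$: (a) if $i=11$: $a_n>0$ if $n\equiv0,2,5,8\pmod9$ and $a_n<0$ otherwise; (b) if $i=12$: $a_n>0$ if $n\equiv0,2,5,8\pmod9$, $a_n<0$ if $n\equiv1,4,7\pmod9$, and $a_n=0$ if $n\equiv3,6\pmod9$; (c) if $i>12$: $a_n>0$ if $n\equiv0,2\pmod3$ and $a_n<0$ if $n\equiv1\pmod3$.
   Context: For $|q|<1$, $(a;q)_\infty=\prod_{k\ge0}(1-aq^k)$. *)

theory Defs
  imports "HOL-Analysis.Analysis"
begin

definition qpoch_inf :: "real \<Rightarrow> real \<Rightarrow> real" where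
  "qpoch_inf a q = (\<Prod>k. 1 - a * q ^ k)"

end

theory Submission
  imports Defs
begin

text \<open>
  Write \<open>E(q) = (q;q)\<^sub>\<infinity>\<close>. Splitting Jacobi's series for \<open>E(q)\<^sup>3\<close> by exponents modulo 3 gives
  \<open>E(q)\<^sup>3 = P(q\<^sup>3) - 3 q E(q\<^sup>9)\<^sup>3\<close>, where \<open>P(q) = \<Sum>\<^sub>k (-1)\<^sup>k (6k + 1) q\<^bsup>k(3k+1)/2\<^esup>\<close>. Cubing this
  and dividing by \<open>E(q\<^sup>3)\<^sup>i\<close> trisects the quotient. After replacing \<open>q\<^sup>3\<close> by \<open>q\<close>, the classes 1 and 2
  are \<open>-9 P\<^sup>2 E(q\<^sup>3)\<^sup>3 / E\<^sup>i\<close> and \<open>27 P E(q\<^sup>3)\<^sup>6 / E\<^sup>i\<close>. Logarithmic differentiation of the Jacobi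
  triple product gives
  \<open>P / E = 1 + 6 \<Sum>\<^sub>k (q\<^bsup>3k+1\<^esup> / (1 - q\<^bsup>3k+1\<^esup>) - q\<^bsup>3k+2\<^esup> / (1 - q\<^bsup>3k+2\<^esup>))\<close>,
  and every summand becomes nonnegative after division by \<open>1 - q\<close>, so that \<open>P / E\<^sup>2\<close> is nonnegative.

  The class 0 is \<open>(P\<^sup>3 - 27 q E(q\<^sup>3)\<^sup>9) / E\<^sup>i\<close>, whose numerator is the norm of \<open>E\<^sup>3\<close> from series in
  \<open>q\<close> to series in \<open>q\<^sup>3\<close> (the product over the substitutions \<open>q \<mapsto> \<omega>q\<close> with \<open>\<omega>\<^sup>3 = 1\<close>); the product
  formula for \<open>E\<close> evaluates it as \<open>E\<^bsup>12\<^esup> / E(q\<^sup>3)\<^sup>3\<close>. This settles \<open>i \<ge> 12\<close>, and for \<open>i = 11\<close> the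
  remaining factor \<open>E\<close> is trisected by the pentagonal number theorem into three theta products,
  each of which divides \<open>E\<close>; the reciprocals of the quotients are nonnegative.
\<close>

unbundle no vec_syntax and fps_syntax

section \<open>Infinite products as formal power series\<close>


lemma fps_nth_compose_X_power:
  assumes "m > 0"
  shows "(F oo fps_X ^ m) $ n = (if m dvd n then F $ (n div m) else (0 :: 'a::comm_ring_1))"
proof -
  have "(F oo fps_X ^ m) $ n = (\<Sum>i = 0..n. if n = m * i then F $ i else 0)"
    unfolding fps_compose_def by (simp flip: power_mult) (rule sum.cong; simp)
  also have "\<dots> = (\<Sum>i\<in>{i \<in> {0..n}. n = m * i}. F $ i)"
    by (rule sum.inter_filter [symmetric]) simp
  also have "{i \<in> {0..n}. n = m * i} = (if m dvd n then {n div m} else {})"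
    using assms by auto
  finally show ?thesis by simp
qed

text \<open>Congruence modulo \<open>X ^ N\<close>. Identities between infinite products and series
  are proved by comparing finite truncations for every N.\<close>

definition fps_cong :: "nat \<Rightarrow> 'a::zero fps \<Rightarrow> 'a fps \<Rightarrow> bool" where
  "fps_cong N F G \<longleftrightarrow> (\<forall>k<N. F $ k = G $ k)"

lemma fps_cong_refl [simp, intro]: "fps_cong N F F"
  by (simp add: fps_cong_def)

lemma fps_cong_sym: "fps_cong N F G \<Longrightarrow> fps_cong N G F"
  by (simp add: fps_cong_def)

lemma fps_cong_trans [trans]: "fps_cong N F G \<Longrightarrow> fps_cong N G H \<Longrightarrow> fps_cong N F H"
  by (simp add: fps_cong_def)

lemma fps_cong_imp_eq: "(\<And>N. fps_cong N F G) \<Longrightarrow> F = G"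
  unfolding fps_cong_def fps_eq_iff using lessI by blast

lemma fps_cong_add:
  "fps_cong N F F' \<Longrightarrow> fps_cong N G G' \<Longrightarrow> fps_cong N (F + G) (F' + G')"
  by (simp add: fps_cong_def)

lemma fps_cong_diff:
  fixes F :: "'a::ab_group_add fps"
  shows "fps_cong N F F' \<Longrightarrow> fps_cong N G G' \<Longrightarrow> fps_cong N (F - G) (F' - G')"
  by (simp add: fps_cong_def)

lemma fps_cong_mult:
  assumes "fps_cong N F F'" "fps_cong N G G'"
  shows "fps_cong N (F * G) (F' * G')"
  unfolding fps_cong_def fps_mult_nth
  using assms by (auto intro!: sum.cong arg_cong2[of _ _ _ _ "(*)"] simp: fps_cong_def)

lemma fps_cong_sum:
  "(\<And>i. i \<in> I \<Longrightarrow> fps_cong N (F i) (G i)) \<Longrightarrow> fps_cong N (sum F I) (sum G I)"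
  by (auto simp: fps_cong_def fps_sum_nth intro!: sum.cong)

lemma fps_cong_power:
  fixes F :: "'a::comm_semiring_1 fps"
  shows "fps_cong N F G \<Longrightarrow> fps_cong N (F ^ n) (G ^ n)"
  by (induction n) (auto intro: fps_cong_mult)

lemma fps_cong_inverse:
  fixes F :: "'a::field fps"
  assumes "fps_cong N F G" "F $ 0 \<noteq> 0" "G $ 0 \<noteq> 0"
  shows "fps_cong N (inverse F) (inverse G)"
proof -
  have "fps_cong N (inverse F * (F * inverse G)) (inverse F * (G * inverse G))"
    by (intro fps_cong_mult assms fps_cong_refl)
  moreover have "inverse F * (F * inverse G) = inverse G"
    using assms(2) by (simp add: inverse_mult_eq_1 flip: mult.assoc)
  moreover have "inverse F * (G * inverse G) = inverse F"
    using assms(3) by (simp add: inverse_mult_eq_1')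
  ultimately show ?thesis by (simp add: fps_cong_sym)
qed

lemma fps_cong_X_power: "N \<le> k \<Longrightarrow> fps_cong N (fps_X ^ k * F) (0 :: 'a::comm_ring_1 fps)"
  by (simp add: fps_cong_def fps_X_power_mult_nth)

lemma fps_cong_compose_X_power:
  fixes F :: "'a::comm_ring_1 fps"
  assumes "fps_cong N F G" "m > 0"
  shows "fps_cong N (F oo fps_X ^ m) (G oo fps_X ^ m)"
  unfolding fps_cong_def
proof (intro allI impI)
  fix k assume "k < N"
  moreover have "k div m \<le> k" by simp
  ultimately have "k div m < N" by linarith
  thus "(F oo fps_X ^ m) $ k = (G oo fps_X ^ m) $ k"
    using assms by (simp add: fps_nth_compose_X_power fps_cong_def)
qed

section \<open>Euler products over a set of exponents\<close>

definition partial_euler :: "nat set \<Rightarrow> nat \<Rightarrow> real fps" where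
  "partial_euler S n = (\<Prod>k\<in>S \<inter> {1..n}. 1 - fps_X ^ k)"

text \<open>The coefficient at n is stable once all factors of index up to n are present, because
  later factors are 1 modulo \<open>X ^ (n + 1)\<close>. For \<open>S = {Suc 0..}\<close> this is
  the formal \<open>(q;q)\<close> product; other sets give its partial factors.\<close>

definition euler_prod :: "nat set \<Rightarrow> real fps" where
  "euler_prod S = Abs_fps (\<lambda>n. partial_euler S n $ n)"

lemma partial_euler_0 [simp]: "partial_euler S 0 = 1"
  by (simp add: partial_euler_def)

lemma partial_euler_Suc:
  "partial_euler S (Suc n) =
     (if Suc n \<in> S then (1 - fps_X ^ Suc n) * partial_euler S n else partial_euler S n)"
proof -
  have "S \<inter> {1..Suc n} = (if Suc n \<in> S then insert (Suc n) (S \<inter> {1..n}) else S \<inter> {1..n})"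
    by (auto simp: le_Suc_eq)
  thus ?thesis by (simp add: partial_euler_def)
qed

lemma partial_euler_cong_partial_euler:
  "n \<le> m \<Longrightarrow> fps_cong (Suc n) (partial_euler S m) (partial_euler S n)"
proof (induction m rule: dec_induct)
  case (step m)
  have "fps_cong (Suc n) ((1 - fps_X ^ Suc m) * partial_euler S m) (1 * partial_euler S m)"
    by (intro fps_cong_mult fps_cong_refl) (use step.hyps in \<open>simp add: fps_cong_def del: power_Suc\<close>)
  thus ?case using step.IH by (auto simp: partial_euler_Suc intro: fps_cong_trans)
qed simp

lemma euler_prod_cong: "N \<le> Suc n \<Longrightarrow> fps_cong N (euler_prod S) (partial_euler S n)"
  unfolding fps_cong_def euler_prod_def
proof safe
  fix k assume "N \<le> Suc n" "k < N"
  thus "Abs_fps (\<lambda>n. partial_euler S n $ n) $ k = partial_euler S n $ k"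
    using partial_euler_cong_partial_euler[of k n S] by (simp add: fps_cong_def)
qed

lemma partial_euler_nth_0 [simp]: "partial_euler S n $ 0 = 1"
  by (induction n) (simp_all add: partial_euler_Suc)

lemma euler_prod_nth_0 [simp]: "euler_prod S $ 0 = 1"
  by (simp add: euler_prod_def)

lemma euler_prod_Un:
  assumes "S \<inter> T = {}"
  shows "euler_prod (S \<union> T) = euler_prod S * euler_prod T"
proof (rule fps_cong_imp_eq)
  fix N
  have "fps_cong N (euler_prod (S \<union> T)) (partial_euler (S \<union> T) N)"
    by (rule euler_prod_cong) simp
  also have "partial_euler (S \<union> T) N = partial_euler S N * partial_euler T N"
    unfolding partial_euler_def Int_Un_distrib2
    by (rule prod.union_disjoint) (use assms in auto)
  also have "fps_cong N \<dots> (euler_prod S * euler_prod T)"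
    by (intro fps_cong_mult fps_cong_sym[OF euler_prod_cong]) auto
  finally show "fps_cong N (euler_prod (S \<union> T)) (euler_prod S * euler_prod T)" .
qed

lemma partial_euler_compose:
  assumes "m > 0"
  shows "partial_euler S n oo fps_X ^ m = partial_euler ((*) m ` S) (m * n)"
proof -
  have "(*) m ` S \<inter> {1..m * n} = (*) m ` (S \<inter> {1..n})"
    using assms by force
  thus ?thesis using assms
    by (simp add: partial_euler_def fps_compose_prod_distrib fps_compose_sub_distrib prod.reindex
        inj_on_def power_mult fps_X_fps_compose_startby0 flip: fps_compose_power)
qed

lemma euler_prod_compose:
  assumes "m > 0"
  shows "euler_prod S oo fps_X ^ m = euler_prod ((*) m ` S)"
proof (rule fps_cong_imp_eq)
  fix N
  have "fps_cong N (euler_prod S oo fps_X ^ m) (partial_euler S N oo fps_X ^ m)"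
    by (intro fps_cong_compose_X_power euler_prod_cong assms) simp
  also have "fps_cong N \<dots> (euler_prod ((*) m ` S))"
    unfolding partial_euler_compose[OF assms]
    by (intro fps_cong_sym[OF euler_prod_cong]) (use assms in \<open>cases m; simp\<close>)
  finally show "fps_cong N (euler_prod S oo fps_X ^ m) (euler_prod ((*) m ` S))" .
qed

section \<open>The Euler product as the power series of the analytic infinite product\<close>

text \<open>The factor \<open>1 - X ^ Suc n\<close> subtracts the coefficient at
  \<open>k - Suc n\<close>, whose bound is smaller by \<open>(1/2) ^ Suc n\<close> under the weight
  \<open>2 ^ k\<close>. The product on the right stays bounded in n, which gives a majorant uniform
  in n.\<close>

lemma abs_nth_partial_euler_le: "\<bar>partial_euler {Suc 0..} n $ k\<bar> \<le> (\<Prod>i=1..n. 1 + (1/2) ^ i) * 2 ^ k"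
proof (induction n arbitrary: k)
  case (Suc n)
  let ?C = "\<Prod>i=1..n. 1 + (1/2::real) ^ i"
  have C: "0 \<le> ?C" by (intro prod_nonneg) auto
  have "partial_euler {Suc 0..} (Suc n) $ k =
      partial_euler {Suc 0..} n $ k - (if k < Suc n then 0 else partial_euler {Suc 0..} n $ (k - Suc n))"
    by (simp add: partial_euler_Suc left_diff_distrib fps_X_power_mult_nth del: power_Suc)
  also have "\<bar>\<dots>\<bar> \<le> ?C * 2 ^ k + (1/2) ^ Suc n * (?C * 2 ^ k)"
  proof (cases "k < Suc n")
    case True
    thus ?thesis using Suc.IH[of k] C by (simp add: add_increasing2)
  next
    case False
    have "?C * 2 ^ (k - Suc n) = (1/2) ^ Suc n * (?C * 2 ^ k)"
      using False by (simp add: power_diff power_divide)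
    moreover have "\<bar>partial_euler {Suc 0..} n $ k - partial_euler {Suc 0..} n $ (k - Suc n)\<bar>
        \<le> ?C * 2 ^ k + ?C * 2 ^ (k - Suc n)"
      using Suc.IH[of k] Suc.IH[of "k - Suc n"] by linarith
    ultimately show ?thesis using False by (simp only: if_False)
  qed
  also have "\<dots> = (\<Prod>i=1..Suc n. 1 + (1/2) ^ i) * 2 ^ k"
    by (simp add: algebra_simps)
  finally show ?case .
qed simp

lemma prod_one_plus_half_powers_le: "(\<Prod>i=1..n. 1 + (1/2::real) ^ i) \<le> exp 1"
proof -
  have "(\<Prod>i=1..n. 1 + (1/2::real) ^ i) \<le> (\<Prod>i=1..n. exp ((1/2) ^ i))"
    by (intro prod_mono) (auto simp: add_nonneg_nonneg)
  also have "\<dots> = exp (\<Sum>i=1..n. (1/2) ^ i)" by (simp add: exp_sum)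
  also have "(\<Sum>i=1..n. (1/2::real) ^ i) = 1 - (1/2) ^ n"
    by (induction n) auto
  finally show ?thesis by (smt (verit) exp_le_cancel_iff zero_le_power divide_nonneg_nonneg)
qed

lemma eval_partial_euler: "eval_fps (partial_euler {Suc 0..} n) q = (\<Prod>k<n. 1 - q * q ^ k)"
  and partial_euler_radius: "fps_conv_radius (partial_euler {Suc 0..} n) = \<infinity>"
proof (induction n)
  case (Suc n)
  let ?Y = "1 - fps_X ^ Suc n :: real fps"
  have eq: "partial_euler {Suc 0..} (Suc n) = ?Y * partial_euler {Suc 0..} n"
    by (simp add: partial_euler_Suc)
  have Y: "fps_conv_radius ?Y = \<infinity>"
    using fps_conv_radius_diff[of 1 "fps_X ^ Suc n :: real fps"] by (simp del: power_Suc)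
  have evY: "eval_fps ?Y q = 1 - q * q ^ n"
    by (subst eval_fps_diff) (simp_all del: power_Suc, simp)
  {
    case 1
    show ?case unfolding eq using Suc Y evY
      by (subst eval_fps_mult) (simp_all add: mult.commute del: power_Suc)
  next
    case 2
    show ?case unfolding eq using fps_conv_radius_mult[of ?Y "partial_euler {Suc 0..} n"] Suc Y
      by simp
  }
qed simp_all

text \<open>Tannery's theorem exchanges the limit over partial products with the sum over
  coefficients, using the uniform majorant.\<close>

lemma qpoch_inf_has_fps_expansion: "(\<lambda>q. qpoch_inf q q) has_fps_expansion euler_prod {Suc 0..}"
proof (rule has_fps_expansionI)
  \<comment> \<open>Against coefficients of size \<open>exp 1 * 2 ^ k\<close>, the radius 1/4 leaves
    the geometric majorant \<open>exp 1 * (1/2) ^ k\<close>; an expansion at 0 requires only some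
    neighbourhood.\<close>
  have "(\<lambda>n. euler_prod {Suc 0..} $ n * q ^ n) sums qpoch_inf q q" if q: "\<bar>q\<bar> < 1/4" for q :: real
  proof -
    let ?a = "\<lambda>k n. partial_euler {Suc 0..} n $ k * q ^ k"
    let ?M = "\<lambda>k. exp 1 * (1/2) ^ k"
    have lim: "(\<lambda>n. ?a k n) \<longlonglongrightarrow> euler_prod {Suc 0..} $ k * q ^ k" for k
    proof (intro tendsto_eventually eventually_sequentiallyI[of k])
      fix n assume "n \<ge> k"
      thus "?a k n = euler_prod {Suc 0..} $ k * q ^ k"
        using euler_prod_cong[of "Suc k" n "{Suc 0..}"] by (simp add: fps_cong_def)
    qed
    have bound: "norm (?a k n) \<le> ?M k" for k n
    proof -
      have "\<bar>partial_euler {Suc 0..} n $ k\<bar> \<le> exp 1 * 2 ^ k"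
        using abs_nth_partial_euler_le[of n k] prod_one_plus_half_powers_le[of n]
        by (meson mult_right_mono order_trans zero_le_numeral zero_le_power)
      moreover have "\<bar>q\<bar> ^ k \<le> (1/4) ^ k" using q by (intro power_mono) auto
      ultimately have "norm (?a k n) \<le> (exp 1 * 2 ^ k) * (1/4) ^ k"
        unfolding real_norm_def abs_mult power_abs by (intro mult_mono) auto
      also have "\<dots> = ?M k" by (simp flip: power_mult_distrib)
      finally show ?thesis .
    qed
    have ev: "\<forall>\<^sub>F (k, n) in at_top \<times>\<^sub>F sequentially. norm (?a k n) \<le> ?M k"
      by (intro always_eventually) (use bound in auto)
    have "summable (\<lambda>k. norm (euler_prod {Suc 0..} $ k * q ^ k)) \<and>
          (\<lambda>n. \<Sum>k. ?a k n) \<longlonglongrightarrow> (\<Sum>k. euler_prod {Suc 0..} $ k * q ^ k)"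
      using tannerys_theorem[where a = ?a and M = ?M, OF lim ev] by (simp add: summable_mult)
    hence summ: "summable (\<lambda>k. euler_prod {Suc 0..} $ k * q ^ k)"
      and conv: "(\<lambda>n. \<Prod>k<n. 1 - q * q ^ k) \<longlonglongrightarrow> (\<Sum>k. euler_prod {Suc 0..} $ k * q ^ k)"
      by (blast intro: summable_norm_cancel, simp add: eval_fps_def flip: eval_partial_euler)
    have "summable (\<lambda>k. norm (- (q * q ^ k)))"
      using q unfolding norm_minus_cancel norm_mult norm_power
      by (intro summable_mult summable_geometric) auto
    hence "convergent_prod (\<lambda>k. 1 + (- (q * q ^ k)))"
      by (intro abs_convergent_prod_imp_convergent_prod summable_imp_abs_convergent_prod) simp
    hence "(\<lambda>n. \<Prod>k\<le>n. 1 - q * q ^ k) \<longlonglongrightarrow> qpoch_inf q q"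
      unfolding qpoch_inf_def using convergent_prod_LIMSEQ by force
    hence "(\<lambda>n. \<Prod>k<n. 1 - q * q ^ k) \<longlonglongrightarrow> qpoch_inf q q"
      by (simp add: LIMSEQ_lessThan_iff_atMost)
    with conv summ show ?thesis by (metis LIMSEQ_unique summable_sums)
  qed
  thus "\<forall>\<^sub>F u in nhds (0::real). (\<lambda>n. euler_prod {Suc 0..} $ n * u ^ n) sums qpoch_inf u u"
    unfolding eventually_nhds_metric by (intro exI[of _ "1/4"]) auto
qed

lemma has_fps_expansion_compose_X_power:
  fixes f :: "real \<Rightarrow> real"
  assumes "f has_fps_expansion F" "m > 0"
  shows "(\<lambda>x. f (x ^ m)) has_fps_expansion (F oo fps_X ^ m)"
proof (rule has_fps_expansionI)
  from assms have "fps_conv_radius F > 0" "\<forall>\<^sub>F z in nhds 0. eval_fps F z = f z"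
    by (auto simp: has_fps_expansion_def)
  hence "\<forall>\<^sub>F z in nhds 0. z \<in> eball 0 (fps_conv_radius F)"
    by (intro eventually_nhds_in_open) (auto simp: zero_ereal_def)
  with \<open>\<forall>\<^sub>F z in nhds 0. eval_fps F z = f z\<close>
  have "\<forall>\<^sub>F z in nhds 0. (\<lambda>n. F $ n * z ^ n) sums f z"
    by eventually_elim (metis dist_0_norm in_eball_iff sums_eval_fps)
  moreover have "filterlim (\<lambda>x::real. x ^ m) (nhds 0) (nhds 0)"
    using assms(2) by (auto intro!: tendsto_eq_intros filterlim_ident)
  ultimately have "\<forall>\<^sub>F x in nhds 0. (\<lambda>n. F $ n * (x ^ m) ^ n) sums f (x ^ m)"
    by (auto simp: filterlim_iff)
  thus "\<forall>\<^sub>F x in nhds 0. (\<lambda>n. (F oo fps_X ^ m) $ n * x ^ n) sums f (x ^ m)"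
  proof eventually_elim
    case (elim x)
    have mono: "strict_mono ((*) m)" using assms(2) by (simp add: strict_mono_def)
    have "(\<lambda>n. (F oo fps_X ^ m) $ (m * n) * x ^ (m * n)) sums f (x ^ m)"
      using elim assms(2) by (simp add: fps_nth_compose_X_power power_mult)
    thus ?case
      using assms(2) by (subst (asm) sums_mono_reindex[OF mono, where f = "\<lambda>n. (F oo fps_X ^ m) $ n * x ^ n"])
        (auto simp: fps_nth_compose_X_power)
  qed
qed

lemma has_fps_expansion_power:
  fixes f :: "real \<Rightarrow> real"
  assumes "f has_fps_expansion F"
  shows "(\<lambda>x. f x ^ n) has_fps_expansion F ^ n"
  by (induction n) (auto intro!: has_fps_expansion_mult assms)

text \<open>Divide \<open>f - g\<close> by the lowest power of x in \<open>F - G\<close>. The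
  quotient is continuous at 0 with the nonzero leading coefficient as its value, yet vanishes at all
  nearby nonzero points.\<close>

lemma has_fps_expansion_unique:
  fixes f g :: "real \<Rightarrow> real"
  assumes "f has_fps_expansion F" "g has_fps_expansion G" "\<forall>\<^sub>F x in nhds 0. f x = g x"
  shows "F = G"
proof (rule ccontr)
  assume "F \<noteq> G"
  hence ne: "F - G \<noteq> 0" by simp
  define d where "d = subdegree (F - G)"
  define h where "h = (\<lambda>x. if x = 0 then (F - G) $ d else (f x - g x) / x ^ d)"
  have "h has_fps_expansion fps_shift d (F - G)"
    unfolding h_def by (intro has_fps_expansion_shift has_fps_expansion_diff assms) (simp_all add: d_def)
  hence "isCont h 0"
    using has_fps_expansion_imp_continuous[of h _ UNIV] by simp
  hence "h \<midarrow>0\<rightarrow> (F - G) $ d" by (simp add: isCont_def h_def)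
  moreover have "\<forall>\<^sub>F x in at 0. h x = 0"
    using eventually_nhds_conv_at[THEN iffD1, OF assms(3)]
    by (auto simp: h_def eventually_at_filter elim: eventually_mono)
  hence "h \<midarrow>0\<rightarrow> 0" by (rule tendsto_eventually)
  ultimately have "(F - G) $ d = 0" by (rule LIM_unique)
  thus False using ne nth_subdegree_nonzero[of "F - G"] by (simp add: d_def)
qed

text \<open>Passage from the analytic hypothesis to formal series. Near 0 the denominator is
  nonzero, being continuous with value 1 at 0, so it can be cleared and expansions compared.\<close>

lemma qpoch_quotient_coeffs:
  fixes a :: "nat \<Rightarrow> real"
  assumes "\<And>q::real. \<bar>q\<bar> < 1 \<Longrightarrow>
      (\<lambda>n. a n * q ^ n) sums (qpoch_inf q q ^ l / qpoch_inf (q ^ 3) (q ^ 3) ^ i)"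
  shows "Abs_fps a * (euler_prod {Suc 0..} oo fps_X ^ 3) ^ i = euler_prod {Suc 0..} ^ l"
proof (rule has_fps_expansion_unique)
  let ?f = "\<lambda>q. qpoch_inf q q ^ l / qpoch_inf (q ^ 3) (q ^ 3) ^ i"
  have E3: "(\<lambda>q. qpoch_inf (q ^ 3) (q ^ 3)) has_fps_expansion (euler_prod {Suc 0..} oo fps_X ^ 3)"
    using has_fps_expansion_compose_X_power[OF qpoch_inf_has_fps_expansion, of 3] by simp
  have "?f has_fps_expansion Abs_fps a"
    by (rule has_fps_expansionI, unfold eventually_nhds_metric, rule exI[of _ 1])
      (use assms in auto)
  thus "(\<lambda>q. ?f q * qpoch_inf (q ^ 3) (q ^ 3) ^ i) has_fps_expansion
     Abs_fps a * (euler_prod {Suc 0..} oo fps_X ^ 3) ^ i"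
    by (intro has_fps_expansion_mult has_fps_expansion_power E3)
  show "(\<lambda>q. qpoch_inf q q ^ l) has_fps_expansion euler_prod {Suc 0..} ^ l"
    by (intro has_fps_expansion_power qpoch_inf_has_fps_expansion)
  have "qpoch_inf (0 ^ 3) (0 ^ 3) = (1::real)" by (simp add: qpoch_inf_def)
  moreover have "isCont (\<lambda>q::real. qpoch_inf (q ^ 3) (q ^ 3)) 0"
    using has_fps_expansion_imp_continuous[OF E3, of UNIV] by simp
  ultimately have "\<forall>\<^sub>F q in at 0. qpoch_inf (q ^ 3) (q ^ 3) \<noteq> (0::real)"
    unfolding isCont_def by (intro tendsto_imp_eventually_ne[of _ 1]) simp_all
  with \<open>qpoch_inf (0 ^ 3) (0 ^ 3) = 1\<close>
  have "\<forall>\<^sub>F q in nhds 0. qpoch_inf (q ^ 3) (q ^ 3) \<noteq> (0::real)"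
    by (simp add: eventually_nhds_conv_at)
  thus "\<forall>\<^sub>F q in nhds 0. ?f q * qpoch_inf (q ^ 3) (q ^ 3) ^ i = qpoch_inf q q ^ l"
    by eventually_elim simp
qed

text \<open>Factors of index at least N are 1 modulo \<open>X ^ N\<close>, so any finite part of S
  containing all its exponents below N is an admissible truncation.\<close>

lemma prod_cong_euler_prod:
  assumes "finite A" "A \<subseteq> S" "S \<inter> {..<N} \<subseteq> A" "0 \<notin> S"
  shows "fps_cong N (\<Prod>k\<in>A. 1 - fps_X ^ k) (euler_prod S)"
proof (cases N)
  case (Suc M)
  have "S \<inter> {1..M} = A \<inter> {1..M}"
    using assms Suc by auto
  moreover have "(\<Prod>k\<in>A. 1 - fps_X ^ k :: real fps) =
      (\<Prod>k\<in>A \<inter> {1..M}. 1 - fps_X ^ k) * (\<Prod>k\<in>A - {1..M}. 1 - fps_X ^ k)"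
    using assms(1) by (metis mult.commute prod.Int_Diff)
  moreover have "fps_cong N (\<Prod>k\<in>A - {1..M}. 1 - fps_X ^ k :: real fps) 1"
  proof -
    have "fps_cong N (\<Prod>k\<in>B. 1 - fps_X ^ k :: real fps) 1"
      if "finite B" "\<And>k. k \<in> B \<Longrightarrow> N \<le> k" for B
      using that
    proof (induction B)
      case (insert k B)
      have "N \<le> k" by (rule insert.prems) simp
      hence k: "fps_cong N (1 - fps_X ^ k :: real fps) 1" by (simp add: fps_cong_def)
      have "fps_cong N ((1 - fps_X ^ k) * (\<Prod>k\<in>B. 1 - fps_X ^ k :: real fps)) (1 * 1)"
        by (rule fps_cong_mult[OF k insert.IH]) (use insert.prems in auto)
      thus ?case using insert by simp
    qed simp
    moreover have "N \<le> k" if "k \<in> A - {1..M}" for k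
      using that assms Suc by (cases "k = 0") auto
    ultimately show ?thesis using assms(1) by (meson finite_Diff)
  qed
  ultimately have "fps_cong N (\<Prod>k\<in>A. 1 - fps_X ^ k) (partial_euler S M * 1)"
    unfolding partial_euler_def by (metis fps_cong_mult fps_cong_refl)
  also have "fps_cong N (partial_euler S M * 1) (euler_prod S)"
    using euler_prod_cong[of N M S] Suc by (simp add: fps_cong_sym)
  finally show ?thesis .
qed (simp add: fps_cong_def)

section \<open>A finite form of the Jacobi triple product\<close>

text \<open>The formal series with terms \<open>w j * X ^ e j\<close> over all integers j. It has
  this meaning when \<open>e\<close> has finite fibres, since \<open>sum\<close> over an infinite
  set is 0.\<close>

definition theta_sum :: "(int \<Rightarrow> real) \<Rightarrow> (int \<Rightarrow> nat) \<Rightarrow> real fps" where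
  "theta_sum w e = Abs_fps (\<lambda>n. \<Sum>j | e j = n. w j)"

lemma theta_sum_cong:
  assumes "finite J" "\<And>j. e j < N \<Longrightarrow> j \<in> J"
  shows "fps_cong N (\<Sum>j\<in>J. fps_const (w j) * fps_X ^ e j) (theta_sum w e)"
  unfolding fps_cong_def
proof (intro allI impI)
  fix n assume n: "n < N"
  have "(\<Sum>j\<in>J. fps_const (w j) * fps_X ^ e j) $ n = (\<Sum>j\<in>J. if e j = n then w j else 0)"
    unfolding fps_sum_nth by (intro sum.cong) auto
  also have "\<dots> = sum w {j \<in> J. e j = n}"
    by (rule sum.inter_filter [symmetric]) (rule assms)
  also have "{j \<in> J. e j = n} = {j. e j = n}"
    using assms n by auto
  finally show "(\<Sum>j\<in>J. fps_const (w j) * fps_X ^ e j) $ n = theta_sum w e $ n"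
    by (simp add: theta_sum_def)
qed

definition tri :: "int \<Rightarrow> nat" where
  "tri j = nat (j * (j + 1) div 2)"

definition alt :: "int \<Rightarrow> real" where
  "alt j = (if even j then 1 else -1)"

lemma of_nat_tri: "2 * int (tri j) = j * (j + 1)"
proof -
  have "0 \<le> j * (j + 1)" by (cases "j \<ge> 0") (auto intro: mult_nonpos_nonpos)
  moreover have "even (j * (j + 1))" by simp
  ultimately show ?thesis unfolding tri_def by (metis dvd_mult_div_cancel mult_eq_0_iff
      nat_0_le pos_imp_zdiv_nonneg_iff zero_less_numeral)
qed

lemma tri_ge: "\<bar>j\<bar> - 1 \<le> int (tri j)"
proof -
  have "0 \<le> (\<bar>j\<bar> - 1) * (\<bar>j\<bar> - 2)"
    by (cases "\<bar>j\<bar> \<ge> 2") (auto intro: mult_nonpos_nonpos)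
  hence "2 * (\<bar>j\<bar> - 1) \<le> \<bar>j\<bar> * \<bar>j\<bar> - \<bar>j\<bar>" by (simp add: algebra_simps)
  also have "\<dots> \<le> j * j + j" unfolding abs_mult_self by simp
  also have "\<dots> = 2 * int (tri j)" using of_nat_tri[of j] by (simp add: algebra_simps)
  finally show ?thesis by simp
qed

lemma alt_uminus [simp]: "alt (- j) = alt j"
  by (simp add: alt_def)

section \<open>Coefficients of the finite triple product and their recurrence\<close>

definition qfact :: "real fps \<Rightarrow> nat \<Rightarrow> real fps" where
  "qfact Q n = (\<Prod>k<n. 1 - Q ^ Suc k)"

text \<open>Reciprocal q-factorials, extended by 0 so that the recurrence holds on all of \<open>\<int>\<close>.\<close>

definition inv_qfact :: "real fps \<Rightarrow> int \<Rightarrow> real fps" where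
  "inv_qfact Q k = (if k < 0 then 0 else inverse (qfact Q (nat k)))"

lemma qfact_nth_0: "Q $ 0 = 0 \<Longrightarrow> qfact Q n $ 0 = 1"
  by (induction n) (simp_all add: qfact_def)

text \<open>At \<open>k = 0\<close> both sides vanish: the left by the extension by 0, the right
  because \<open>1 - Q ^ 0 = 0\<close>.\<close>

lemma inv_qfact_pred:
  assumes "Q $ 0 = 0" "0 \<le> k"
  shows "inv_qfact Q (k - 1) = (1 - Q ^ nat k) * inv_qfact Q k"
proof (cases "k = 0")
  case False
  define l where "l = nat (k - 1)"
  have k: "nat k = Suc l" "nat (k - 1) = l" "k > 0" using assms False by (auto simp: l_def)
  have "(1 - Q ^ Suc l) * inverse (qfact Q (Suc l)) =
      (1 - Q ^ Suc l) * inverse (1 - Q ^ Suc l) * inverse (qfact Q l)"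
    by (simp add: qfact_def fps_inverse_mult mult_ac)
  also have "(1 - Q ^ Suc l) * inverse (1 - Q ^ Suc l) = 1"
    by (rule inverse_mult_eq_1') (simp add: assms)
  finally show ?thesis using k by (simp add: inv_qfact_def)
qed (simp add: inv_qfact_def)

text \<open>
  The coefficient of \<open>z\<^sup>j\<close> in \<open>(\<Prod>k<n. 1 - z x Q\<^sup>k) (\<Prod>k<m. 1 - y Q\<^sup>k / z)\<close>, where \<open>Q = x y\<close>.
  Below, \<open>jacobi_sum\<close> and \<open>jacobi_dsum\<close> are the value and the \<open>z\<close>-derivative of this product at \<open>z = 1\<close>.
\<close>

definition jacobi_coeff :: "real fps \<Rightarrow> real fps \<Rightarrow> nat \<Rightarrow> nat \<Rightarrow> int \<Rightarrow> real fps" where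
  "jacobi_coeff x y n m j = fps_const (alt j) * x ^ tri j * y ^ tri (- j) *
     (qfact (x * y) (n + m) * inv_qfact (x * y) (m + j) * inv_qfact (x * y) (n - j))"

text \<open>The substitution of 1/z for z interchanges the two products. Through it each recurrence
  in n yields one in m.\<close>

lemma jacobi_coeff_swap: "jacobi_coeff x y n m j = jacobi_coeff y x m n (- j)"
  by (simp add: jacobi_coeff_def mult_ac add_ac)

lemma jacobi_coeff_eq_0: "j < - int m \<or> j > int n \<Longrightarrow> jacobi_coeff x y n m j = 0"
  by (auto simp: jacobi_coeff_def inv_qfact_def)

text \<open>Coefficient comparison after multiplication by the next factor
  \<open>1 - z x Q ^ n\<close>. Once the monomials are aligned it reduces to the q-Pascal rule
  \<open>(1 - Q^l) + Q^l (1 - Q^(m+j)) = 1 - Q^(n+m+1)\<close> with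
  \<open>l = n + 1 - j\<close>.\<close>

lemma jacobi_coeff_Suc:
  assumes Q: "x $ 0 * y $ 0 = 0"
  shows "jacobi_coeff x y (Suc n) m j =
    jacobi_coeff x y n m j - x * (x * y) ^ n * jacobi_coeff x y n m (j - 1)"
\<comment> \<open>This range contains every j at which one of the three coefficients can be nonzero;
  at its two ends the value 0 of \<open>inv_qfact\<close> at -1 supplies the boundary terms.\<close>
proof (cases "0 \<le> m + j \<and> 0 \<le> int n + 1 - j")
  case True
  define Q where "Q = x * y"
  define l where "l = nat (int n + 1 - j)"
  let ?A = "fps_const (alt j) * x ^ tri j * y ^ tri (- j)"
  have Q0: "Q $ 0 = 0" using Q by (simp add: Q_def)
  have l: "int n - j = int l - 1" "int n - (j - 1) = int l" "int (Suc n) - j = int l"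
    using True by (auto simp: l_def)
  have A: "x * Q ^ n * (fps_const (alt (j - 1)) * x ^ tri (j - 1) * y ^ tri (- (j - 1))) =
      - (?A * Q ^ l)"
  proof -
    have "int (Suc (n + tri (j - 1))) = int (tri j + l)"
      using of_nat_tri[of j] of_nat_tri[of "j - 1"] l by (simp add: algebra_simps)
    hence ex: "Suc (n + tri (j - 1)) = tri j + l" by linarith
    have "int (n + tri (- (j - 1))) = int (tri (- j) + l)"
      using of_nat_tri[of "- j"] of_nat_tri[of "- (j - 1)"] l by (simp add: algebra_simps)
    hence ey: "n + tri (- (j - 1)) = tri (- j) + l" by linarith
    have "x * Q ^ n * (fps_const (alt (j - 1)) * x ^ tri (j - 1) * y ^ tri (- (j - 1))) =
      fps_const (alt (j - 1)) * x ^ Suc (n + tri (j - 1)) * y ^ (n + tri (- (j - 1)))"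
      by (simp add: Q_def power_mult_distrib power_add mult_ac)
    also have "\<dots> = - (?A * Q ^ l)"
      unfolding ex ey by (simp add: Q_def power_mult_distrib power_add mult_ac alt_def flip: fps_const_neg)
    finally show ?thesis .
  qed
  have i: "inv_qfact Q (m + (j - 1)) = (1 - Q ^ nat (m + j)) * inv_qfact Q (m + j)"
    using inv_qfact_pred[OF Q0, of "m + j"] True by (simp add: algebra_simps)
  have l': "inv_qfact Q (int l - 1) = (1 - Q ^ l) * inv_qfact Q l"
    using inv_qfact_pred[OF Q0, of l] by simp
  have "int (Suc (n + m)) = int (nat (m + j) + l)"
    using True l by simp
  hence "Suc (n + m) = nat (m + j) + l" by linarith
  hence N: "Q ^ Suc (n + m) = Q ^ nat (m + j) * Q ^ l"
    by (metis power_add)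
  have "jacobi_coeff x y n m j - x * Q ^ n * jacobi_coeff x y n m (j - 1) =
     ?A * (qfact Q (n + m) * inv_qfact Q (m + j) * inv_qfact Q (int l - 1)) -
     x * Q ^ n * (fps_const (alt (j - 1)) * x ^ tri (j - 1) * y ^ tri (- (j - 1))) *
       (qfact Q (n + m) * inv_qfact Q (m + (j - 1)) * inv_qfact Q l)"
    unfolding jacobi_coeff_def Q_def[symmetric] l by (simp add: mult_ac)
  also have "\<dots> = ?A * (qfact Q (n + m) * inv_qfact Q (m + j) * inv_qfact Q l) *
      ((1 - Q ^ l) + Q ^ l * (1 - Q ^ nat (m + j)))"
    unfolding A i l' by (simp add: algebra_simps)
  also have "(1 - Q ^ l) + Q ^ l * (1 - Q ^ nat (m + j)) = 1 - Q ^ Suc (n + m)"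
    unfolding N by (simp add: algebra_simps)
  also have "?A * (qfact Q (n + m) * inv_qfact Q (m + j) * inv_qfact Q l) * (1 - Q ^ Suc (n + m)) =
      jacobi_coeff x y (Suc n) m j"
    unfolding jacobi_coeff_def Q_def[symmetric] l by (simp add: qfact_def mult_ac)
  finally show ?thesis by (simp add: Q_def)
next
  case False
  hence "jacobi_coeff x y (Suc n) m j = 0" "jacobi_coeff x y n m j = 0"
    "jacobi_coeff x y n m (j - 1) = 0"
    by (intro jacobi_coeff_eq_0; auto)+
  thus ?thesis by simp
qed

definition jacobi_sum :: "real fps \<Rightarrow> real fps \<Rightarrow> nat \<Rightarrow> nat \<Rightarrow> real fps" where
  "jacobi_sum x y n m = (\<Sum>j=-int m..int n. jacobi_coeff x y n m j)"

definition jacobi_dsum :: "real fps \<Rightarrow> real fps \<Rightarrow> nat \<Rightarrow> nat \<Rightarrow> real fps" where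
  "jacobi_dsum x y n m = (\<Sum>j=-int m..int n. of_int j * jacobi_coeff x y n m j)"

lemma jacobi_sum_swap: "jacobi_sum x y n m = jacobi_sum y x m n"
  unfolding jacobi_sum_def
  by (rule sum.reindex_bij_witness[of _ uminus uminus]) (auto simp: jacobi_coeff_swap[of x])

lemma jacobi_dsum_swap: "jacobi_dsum x y n m = - jacobi_dsum y x m n"
  unfolding jacobi_dsum_def sum_negf [symmetric]
  by (rule sum.reindex_bij_witness[of _ uminus uminus]) (auto simp: jacobi_coeff_swap[of x])

text \<open>The weights \<open>w j = 1\<close> and \<open>w j = j\<close> give the value and the
  z-derivative at z = 1. The summation bounds can be shifted because the coefficients vanish outside
  \<open>-m..n\<close>.\<close>

lemma jacobi_coeff_weighted_sum_Suc:
  assumes Q: "x $ 0 * y $ 0 = 0"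
  shows "(\<Sum>j=-int m..int (Suc n). w j * jacobi_coeff x y (Suc n) m j) =
    (\<Sum>j=-int m..int n. (w j - x * (x * y) ^ n * w (j + 1)) * jacobi_coeff x y n m j)"
proof -
  let ?c = "jacobi_coeff x y n m"
  have "(\<Sum>j=-int m..int (Suc n). w j * jacobi_coeff x y (Suc n) m j) =
    (\<Sum>j=-int m..int (Suc n). w j * ?c j) -
    x * (x * y) ^ n * (\<Sum>j=-int m..int (Suc n). w j * ?c (j - 1))"
    by (simp add: jacobi_coeff_Suc[OF Q] sum_subtractf sum_distrib_left algebra_simps)
  also have "(\<Sum>j=-int m..int (Suc n). w j * ?c j) = (\<Sum>j=-int m..int n. w j * ?c j)"
    by (rule sum.mono_neutral_right) (auto simp: jacobi_coeff_eq_0)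
  also have "(\<Sum>j=-int m..int (Suc n). w j * ?c (j - 1)) =
      (\<Sum>j=-int m+1..int n+1. w j * ?c (j - 1))"
    by (rule sum.mono_neutral_right) (auto simp: jacobi_coeff_eq_0)
  also have "\<dots> = (\<Sum>j=-int m..int n. w (j + 1) * ?c j)"
    by (rule sum.reindex_bij_witness[of _ "\<lambda>j. j + 1" "\<lambda>j. j - 1"]) auto
  finally show ?thesis
    by (simp add: sum_subtractf sum_distrib_left algebra_simps)
qed

lemma jacobi_sum_Suc:
  "x $ 0 * y $ 0 = 0 \<Longrightarrow> jacobi_sum x y (Suc n) m = (1 - x * (x * y) ^ n) * jacobi_sum x y n m"
  using jacobi_coeff_weighted_sum_Suc[of x y "\<lambda>_. 1" n m]
  by (simp add: jacobi_sum_def sum_distrib_left)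

text \<open>The product rule at z = 1 for the new factor \<open>1 - z x Q ^ n\<close>.\<close>

lemma jacobi_dsum_Suc:
  assumes "x $ 0 * y $ 0 = 0"
  shows "jacobi_dsum x y (Suc n) m =
    (1 - x * (x * y) ^ n) * jacobi_dsum x y n m - x * (x * y) ^ n * jacobi_sum x y n m"
  using jacobi_coeff_weighted_sum_Suc[OF assms, of of_int n m]
  by (simp add: jacobi_sum_def jacobi_dsum_def sum_distrib_left sum_subtractf sum.distrib algebra_simps)

lemma jacobi_sum_Suc':
  "x $ 0 * y $ 0 = 0 \<Longrightarrow> jacobi_sum x y n (Suc m) = (1 - y * (x * y) ^ m) * jacobi_sum x y n m"
  using jacobi_sum_Suc[of y x m n] by (simp add: jacobi_sum_swap[of x] mult.commute)

lemma jacobi_dsum_Suc':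
  assumes "x $ 0 * y $ 0 = 0"
  shows "jacobi_dsum x y n (Suc m) =
    (1 - y * (x * y) ^ m) * jacobi_dsum x y n m + y * (x * y) ^ m * jacobi_sum x y n m"
  using jacobi_dsum_Suc[of y x m n] assms
  by (simp add: jacobi_sum_swap[of x] jacobi_dsum_swap[of x] mult.commute algebra_simps)

lemma jacobi_sum_0: "jacobi_sum x y 0 0 = 1"
  by (simp add: jacobi_sum_def jacobi_coeff_def tri_def alt_def inv_qfact_def qfact_def)

lemma jacobi_dsum_0: "jacobi_dsum x y 0 0 = 0"
  by (simp add: jacobi_dsum_def)

lemma jacobi_sum_eq:
  assumes "x $ 0 * y $ 0 = 0"
  shows "jacobi_sum x y n m = (\<Prod>k<n. 1 - x * (x * y) ^ k) * (\<Prod>k<m. 1 - y * (x * y) ^ k)"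
proof -
  have "jacobi_sum x y 0 m = (\<Prod>k<m. 1 - y * (x * y) ^ k)"
    by (induction m) (simp_all add: jacobi_sum_0 jacobi_sum_Suc'[OF assms] mult.commute)
  thus ?thesis
    by (induction n) (simp_all add: jacobi_sum_Suc[OF assms] mult.assoc mult.left_commute)
qed

section \<open>The Jacobi triple product and its derivative\<close>

definition arith_prog :: "nat \<Rightarrow> nat \<Rightarrow> nat set" where
  "arith_prog a d = range (\<lambda>k. a + k * d)"

lemma partial_arith_prog_cong:
  assumes "0 < a" "0 < d" "N \<le> n"
  shows "fps_cong N (\<Prod>k<n. 1 - fps_X ^ (a + k * d)) (euler_prod (arith_prog a d))"
proof -
  have inj: "inj_on (\<lambda>k. a + k * d) {..<n}" using assms by (auto simp: inj_on_def)
  have "k < n" if "a + k * d < N" for k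
  proof -
    have "k \<le> k * d" using assms by simp
    thus ?thesis using that assms by linarith
  qed
  hence "fps_cong N (\<Prod>k\<in>(\<lambda>k. a + k * d) ` {..<n}. 1 - fps_X ^ k) (euler_prod (arith_prog a d))"
    by (intro prod_cong_euler_prod) (use assms in \<open>auto simp: arith_prog_def\<close>)
  thus ?thesis by (simp add: prod.reindex[OF inj])
qed

lemma qfact_cong:
  assumes "0 < d" "N \<le> n"
  shows "fps_cong N (qfact (fps_X ^ d) n) (euler_prod (arith_prog d d))"
proof -
  have "qfact (fps_X ^ d) n = (\<Prod>k<n. 1 - fps_X ^ (d + k * d))"
    by (simp add: qfact_def mult.commute flip: power_mult power_add)
  thus ?thesis using partial_arith_prog_cong[of d d N n] assms by simp
qed

text \<open>The exponent of X in \<open>x ^ tri j * y ^ tri (- j)\<close> at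
  \<open>x = X ^ a\<close> and \<open>y = X ^ b\<close>, that is,
  \<open>((a + b) j^2 + (a - b) j) / 2\<close>.\<close>

definition theta_exp :: "nat \<Rightarrow> nat \<Rightarrow> int \<Rightarrow> nat" where
  "theta_exp a b j = a * tri j + b * tri (- j)"

text \<open>Gives finite fibres, and confines the indices with exponent below N to
  \<open>\<bar>j\<bar> \<le> N\<close>.\<close>

lemma theta_exp_ge: "0 < a \<Longrightarrow> \<bar>j\<bar> - 1 \<le> int (theta_exp a b j)"
proof -
  assume "0 < a"
  hence "tri j \<le> theta_exp a b j" by (simp add: theta_exp_def trans_le_add1)
  thus ?thesis using tri_ge[of j] by linarith
qed

text \<open>For \<open>\<bar>j\<bar> \<le> N\<close> all three q-factorials have at least N factors,
  so each agrees with the infinite product \<open>G\<close> modulo \<open>X ^ N\<close> and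
  everything but the monomial cancels. For larger \<open>\<bar>j\<bar>\<close> the exponent is at
  least N and both sides are 0.\<close>

lemma jacobi_coeff_cong:
  assumes "0 < a" "2 * N \<le> n" "2 * N \<le> m"
  shows "fps_cong N (euler_prod (arith_prog (a + b) (a + b)) * jacobi_coeff (fps_X ^ a) (fps_X ^ b) n m j)
    (fps_const (alt j) * fps_X ^ theta_exp a b j)"
proof (cases "\<bar>j\<bar> \<le> int N")
  case True
  define G where "G = euler_prod (arith_prog (a + b) (a + b))"
  define M where "M = fps_const (alt j) * fps_X ^ theta_exp a b j"
  define Q :: "real fps" where "Q = fps_X ^ (a + b)"
  have j: "0 \<le> m + j" "0 \<le> n - j" "N \<le> nat (m + j)" "N \<le> nat (n - j)"
    using True assms by auto
  have Q0: "Q $ 0 = 0" using assms by (simp add: Q_def)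
  have qf: "fps_cong N (qfact Q k) G" if "N \<le> k" for k
    unfolding Q_def G_def using that assms by (intro qfact_cong) auto
  have inv: "fps_cong N (inverse (qfact Q k)) (inverse G)" if "N \<le> k" for k
    using that by (intro fps_cong_inverse qf) (simp_all add: qfact_nth_0 Q0 G_def)
  have "G * jacobi_coeff (fps_X ^ a) (fps_X ^ b) n m j =
     G * (M * (qfact Q (n + m) * inverse (qfact Q (nat (m + j))) * inverse (qfact Q (nat (n - j)))))"
    using j by (simp add: jacobi_coeff_def M_def theta_exp_def Q_def inv_qfact_def power_add power_mult mult_ac)
  also have "fps_cong N \<dots> (G * (M * (G * inverse G * inverse G)))"
    using j assms by (intro fps_cong_mult fps_cong_refl qf inv) auto
  also have "G * (M * (G * inverse G * inverse G)) = M * (G * inverse G) * (G * inverse G)"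
    by (simp add: mult_ac)
  also have "G * inverse G = 1"
    by (rule inverse_mult_eq_1') (simp add: G_def)
  finally show ?thesis by (simp add: G_def M_def)
next
  case False
  hence e: "N \<le> theta_exp a b j" using theta_exp_ge[OF assms(1), of j b] by linarith
  have "euler_prod (arith_prog (a + b) (a + b)) * jacobi_coeff (fps_X ^ a) (fps_X ^ b) n m j =
     fps_X ^ theta_exp a b j * (euler_prod (arith_prog (a + b) (a + b)) * (fps_const (alt j) *
      (qfact (fps_X ^ a * fps_X ^ b) (n + m) * inv_qfact (fps_X ^ a * fps_X ^ b) (m + j) *
       inv_qfact (fps_X ^ a * fps_X ^ b) (n - j))))"
    by (simp add: jacobi_coeff_def theta_exp_def power_add power_mult mult_ac)
  also have "fps_cong N \<dots> 0" using e by (rule fps_cong_X_power)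
  also have "fps_cong N 0 (fps_const (alt j) * fps_X ^ theta_exp a b j)"
    using fps_cong_sym[OF fps_cong_X_power[OF e]] by (simp add: mult.commute)
  finally show ?thesis .
qed

lemma finite_theta_exp:
  assumes "0 < a" shows "finite {j. theta_exp a b j = n}"
proof (rule finite_subset)
  show "{j. theta_exp a b j = n} \<subseteq> {-int n - 1..int n + 1}"
  proof
    fix j assume "j \<in> {j. theta_exp a b j = n}"
    thus "j \<in> {-int n - 1..int n + 1}" using theta_exp_ge[OF assms, of j b] by auto
  qed
qed simp

lemma jacobi_weighted_sum_cong:
  assumes "0 < a" "2 * N \<le> n" "2 * N \<le> m"
  shows "fps_cong N (euler_prod (arith_prog (a + b) (a + b)) *
      (\<Sum>j=-int m..int n. fps_const (w j) * jacobi_coeff (fps_X ^ a) (fps_X ^ b) n m j))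
    (theta_sum (\<lambda>j. w j * alt j) (theta_exp a b))"
proof (cases "N = 0")
  case False
  let ?G = "euler_prod (arith_prog (a + b) (a + b))"
  have "?G * (\<Sum>j=-int m..int n. fps_const (w j) * jacobi_coeff (fps_X ^ a) (fps_X ^ b) n m j) =
    (\<Sum>j=-int m..int n. fps_const (w j) * (?G * jacobi_coeff (fps_X ^ a) (fps_X ^ b) n m j))"
    by (simp add: sum_distrib_left mult_ac)
  also have "fps_cong N \<dots>
    (\<Sum>j=-int m..int n. fps_const (w j) * (fps_const (alt j) * fps_X ^ theta_exp a b j))"
    by (intro fps_cong_sum fps_cong_mult fps_cong_refl jacobi_coeff_cong assms)
  also have "\<dots> = (\<Sum>j=-int m..int n. fps_const (w j * alt j) * fps_X ^ theta_exp a b j)"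
    by (simp flip: fps_const_mult add: mult.assoc)
  also have "fps_cong N \<dots> (theta_sum (\<lambda>j. w j * alt j) (theta_exp a b))"
  proof (rule theta_sum_cong)
    fix j assume "theta_exp a b j < N"
    thus "j \<in> {-int m..int n}" using theta_exp_ge[OF assms(1), of j b] assms False by auto
  qed simp
  finally show ?thesis .
qed (simp add: fps_cong_def)

lemma jacobi_sum_cong:
  assumes "0 < a" "2 * N \<le> n" "2 * N \<le> m"
  shows "fps_cong N (euler_prod (arith_prog (a + b) (a + b)) * jacobi_sum (fps_X ^ a) (fps_X ^ b) n m)
    (theta_sum alt (theta_exp a b))"
  using jacobi_weighted_sum_cong[OF assms, of b "\<lambda>_. 1"] by (simp add: jacobi_sum_def)

lemma jacobi_dsum_cong:
  assumes "0 < a" "2 * N \<le> n" "2 * N \<le> m"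
  shows "fps_cong N (euler_prod (arith_prog (a + b) (a + b)) * jacobi_dsum (fps_X ^ a) (fps_X ^ b) n m)
    (theta_sum (\<lambda>j. of_int j * alt j) (theta_exp a b))"
  using jacobi_weighted_sum_cong[OF assms, of b of_int]
  by (simp add: jacobi_dsum_def fps_of_int)

theorem jacobi_triple_product:
  assumes "0 < a" "0 < b"
  shows "theta_sum alt (theta_exp a b) =
    euler_prod (arith_prog (a + b) (a + b)) * (euler_prod (arith_prog a (a + b)) * euler_prod (arith_prog b (a + b)))"
proof (rule fps_cong_imp_eq)
  fix N :: nat
  define n where "n = 2 * N"
  have "fps_cong N (theta_sum alt (theta_exp a b))
     (euler_prod (arith_prog (a + b) (a + b)) * jacobi_sum (fps_X ^ a) (fps_X ^ b) n n)"
    using assms by (intro fps_cong_sym[OF jacobi_sum_cong]) (auto simp: n_def)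
  also have "jacobi_sum (fps_X ^ a) (fps_X ^ b) n n =
     (\<Prod>k<n. 1 - fps_X ^ (a + k * (a + b))) * (\<Prod>k<n. 1 - fps_X ^ (b + k * (a + b)))"
    using assms by (subst jacobi_sum_eq) (simp_all add: mult.commute flip: power_mult power_add)
  also have "fps_cong N (euler_prod (arith_prog (a + b) (a + b)) * \<dots>)
     (euler_prod (arith_prog (a + b) (a + b)) * (euler_prod (arith_prog a (a + b)) * euler_prod (arith_prog b (a + b))))"
    using assms by (intro fps_cong_mult fps_cong_refl partial_arith_prog_cong) (auto simp: n_def)
  finally show "fps_cong N (theta_sum alt (theta_exp a b)) \<dots>" .
qed

lemma arith_prog_1: "arith_prog (Suc 0) (Suc 0) = {Suc 0..}"
  unfolding arith_prog_def by (auto simp: image_iff) presburger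

text \<open>At \<open>x = X\<close>, \<open>y = 1\<close> the factor \<open>1 - y Q^0 / z\<close>
  vanishes at z = 1, so the derivative is the product of the remaining factors. Pairing j with
  \<open>-1 - j\<close> turns the right side into Jacobi's sum of
  \<open>(-1)^j (2j + 1) X^(j(j+1)/2)\<close> over \<open>j \<ge> 0\<close>.\<close>

theorem jacobi_cube: "euler_prod {Suc 0..} ^ 3 = theta_sum (\<lambda>j. of_int j * alt j) (theta_exp 1 0)"
proof (rule fps_cong_imp_eq)
  fix N :: nat
  let ?E = "euler_prod {Suc 0..}"
  let ?S = "jacobi_sum fps_X 1" and ?D = "jacobi_dsum fps_X 1"
  define n where "n = Suc (2 * N)"
  have S0: "?S k (Suc m) = 0" for k m
    using prod.lessThan_Suc_shift[of "\<lambda>k. 1 - fps_X ^ k :: real fps" m]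
    by (subst jacobi_sum_eq) simp_all
  have D1: "?D k (Suc 0) = (\<Prod>l<k. 1 - fps_X ^ Suc l)" for k
    by (simp add: jacobi_dsum_Suc' jacobi_sum_eq)
  have D: "?D k (Suc m) = (\<Prod>l<k. 1 - fps_X ^ Suc l) * (\<Prod>l<m. 1 - fps_X ^ Suc l)" for k m
    by (induction m) (simp_all add: D1 jacobi_dsum_Suc'[of _ _ _ "Suc _"] S0 mult_ac)
  have "fps_cong N (theta_sum (\<lambda>j. of_int j * alt j) (theta_exp 1 0)) (?E * ?D n (Suc n))"
    using fps_cong_sym[OF jacobi_dsum_cong[of 1 N n "Suc n" 0]] by (simp add: n_def arith_prog_1)
  also have "fps_cong N \<dots> (?E * (?E * ?E))"
    unfolding D using partial_arith_prog_cong[of 1 1 N n]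
    by (intro fps_cong_mult fps_cong_refl) (simp_all add: n_def arith_prog_1)
  finally show "fps_cong N (?E ^ 3) (theta_sum (\<lambda>j. of_int j * alt j) (theta_exp 1 0))"
    by (simp add: fps_cong_sym power3_eq_cube mult.assoc)
qed

text \<open>Logarithmic differentiation in z at z = 1: the factor \<open>1 - z u\<close> contributes
  \<open>- u / (1 - u)\<close> and the factor \<open>1 - v / z\<close> contributes
  \<open>v / (1 - v)\<close>. The zero constant terms make these factors invertible.\<close>

lemma jacobi_dsum_log_derivative:
  assumes "x $ 0 = 0" "y $ 0 = 0"
  shows "jacobi_dsum x y n n = jacobi_sum x y n n *
    (\<Sum>k<n. y * (x * y) ^ k * inverse (1 - y * (x * y) ^ k) - x * (x * y) ^ k * inverse (1 - x * (x * y) ^ k))"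
proof (induction n)
  case (Suc n)
  define u v where "u = x * (x * y) ^ n" and "v = y * (x * y) ^ n"
  let ?S = "jacobi_sum x y n n"
  have u: "(1 - u) * inverse (1 - u) = 1" and v: "(1 - v) * inverse (1 - v) = 1"
    using assms by (intro inverse_mult_eq_1'; simp add: u_def v_def)+
  have "jacobi_dsum x y (Suc n) (Suc n) =
      (1 - v) * (1 - u) * jacobi_dsum x y n n + ((1 - u) * v - (1 - v) * u) * ?S"
    using assms by (simp add: jacobi_dsum_Suc jacobi_dsum_Suc' jacobi_sum_Suc u_def v_def)
      (simp add: algebra_simps)
  also have "(1 - u) * v - (1 - v) * u =
      (1 - v) * (1 - u) * (v * inverse (1 - v) - u * inverse (1 - u))"
    using u v by algebra
  finally show ?case
    using assms unfolding Suc.IH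
    by (simp add: jacobi_sum_Suc jacobi_sum_Suc' flip: u_def v_def) (simp add: algebra_simps)
qed (simp add: jacobi_dsum_0)

lemma theta_derivative_cong:
  assumes "0 < a" "0 < b" "2 * N \<le> n"
  shows "fps_cong N (theta_sum (\<lambda>j. of_int j * alt j) (theta_exp a b))
    (theta_sum alt (theta_exp a b) *
      (\<Sum>k<n. fps_X ^ (b + k * (a + b)) * inverse (1 - fps_X ^ (b + k * (a + b))) -
              fps_X ^ (a + k * (a + b)) * inverse (1 - fps_X ^ (a + k * (a + b)))))"
  (is "fps_cong N ?L (_ * ?s)")
proof -
  let ?G = "euler_prod (arith_prog (a + b) (a + b))"
  have "fps_cong N ?L (?G * jacobi_dsum (fps_X ^ a) (fps_X ^ b) n n)"
    using assms by (intro fps_cong_sym[OF jacobi_dsum_cong])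
  also have "jacobi_dsum (fps_X ^ a) (fps_X ^ b) n n = jacobi_sum (fps_X ^ a) (fps_X ^ b) n n * ?s"
    using assms by (subst jacobi_dsum_log_derivative) (simp_all add: mult.commute flip: power_mult power_add)
  also have "?G * \<dots> = (?G * jacobi_sum (fps_X ^ a) (fps_X ^ b) n n) * ?s"
    by (simp add: mult.assoc)
  also have "fps_cong N \<dots> (theta_sum alt (theta_exp a b) * ?s)"
    using assms by (intro fps_cong_mult fps_cong_refl jacobi_sum_cong)
  finally show ?thesis .
qed

section \<open>Trisections of theta series\<close>

text \<open>The third class is indexed by \<open>3 * k - 1\<close>, so that the reflection of k can
  match it with the first class in the dissection of the cube.\<close>

lemma theta_sum_trisect:
  assumes fin: "\<And>n. finite {j. e j = n}"
  shows "theta_sum w e = theta_sum (\<lambda>k. w (3 * k)) (\<lambda>k. e (3 * k)) +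
    theta_sum (\<lambda>k. w (3 * k + 1)) (\<lambda>k. e (3 * k + 1)) +
    theta_sum (\<lambda>k. w (3 * k - 1)) (\<lambda>k. e (3 * k - 1))"
proof (rule fps_ext)
  fix n
  define S where "S r = {j. e j = n \<and> (\<exists>k. j = 3 * k + r)}" for r :: int
  have S: "sum w (S r) = (\<Sum>k | e (3 * k + r) = n. w (3 * k + r))" for r
    by (rule sum.reindex_bij_witness[of _ "\<lambda>k. 3 * k + r" "\<lambda>j. (j - r) div 3"])
      (auto simp: S_def)
  have fS: "finite (S r)" for r
    by (rule finite_subset[OF _ fin[of n]]) (auto simp: S_def)
  have "j \<in> S 0 \<union> S 1 \<union> S (-1)" if "e j = n" for j
  proof -
    have "j = 3 * (j div 3) + 0 \<or> j = 3 * (j div 3) + 1 \<or> j = 3 * (j div 3 + 1) + -1" by presburger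
    thus ?thesis using that unfolding S_def by blast
  qed
  hence "{j. e j = n} = S 0 \<union> S 1 \<union> S (-1)"
    by (auto simp: S_def)
  hence "theta_sum w e $ n = sum w (S 0 \<union> S 1 \<union> S (-1))"
    by (simp add: theta_sum_def)
  also have "\<dots> = sum w (S 0) + sum w (S 1) + sum w (S (-1))"
  proof -
    have "S 0 \<inter> S 1 = {}" "(S 0 \<union> S 1) \<inter> S (-1) = {}"
      unfolding S_def by (auto; presburger)+
    thus ?thesis using fS by (simp add: sum.union_disjoint)
  qed
  finally show "theta_sum w e $ n = (theta_sum (\<lambda>k. w (3 * k)) (\<lambda>k. e (3 * k)) +
    theta_sum (\<lambda>k. w (3 * k + 1)) (\<lambda>k. e (3 * k + 1)) +
    theta_sum (\<lambda>k. w (3 * k - 1)) (\<lambda>k. e (3 * k - 1))) $ n"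
    unfolding S by (simp add: theta_sum_def)
qed

lemma theta_sum_shift:
  assumes "m > 0"
  shows "theta_sum w (\<lambda>k. s + m * e k) = fps_X ^ s * (theta_sum w e oo fps_X ^ m)"
proof (rule fps_ext)
  fix n
  show "theta_sum w (\<lambda>k. s + m * e k) $ n = (fps_X ^ s * (theta_sum w e oo fps_X ^ m)) $ n"
  proof (cases "s \<le> n \<and> m dvd (n - s)")
    case True
    then obtain l where "n = s + m * l" by (metis dvdE le_add_diff_inverse)
    thus ?thesis using assms
      by (simp add: theta_sum_def fps_X_power_mult_nth fps_nth_compose_X_power)
  next
    case False
    hence "{j. s + m * e j = n} = {}" by auto
    thus ?thesis using False assms
      by (auto simp: theta_sum_def fps_X_power_mult_nth fps_nth_compose_X_power)
  qed
qed

lemma theta_sum_reindex: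
  assumes "\<And>k. p (p k) = k"
  shows "theta_sum (\<lambda>k. w (p k)) (\<lambda>k. e (p k)) = theta_sum w e"
  unfolding theta_sum_def
  by (intro fps_ext, unfold fps_nth_Abs_fps, rule sum.reindex_bij_witness[of _ p p]) (auto simp: assms)

lemma theta_sum_cmult: "theta_sum (\<lambda>k. c * w k) e = fps_const c * theta_sum w e"
  by (rule fps_ext) (simp add: theta_sum_def sum_distrib_left)

lemma theta_sum_add: "theta_sum (\<lambda>k. v k + w k) e = theta_sum v e + theta_sum w e"
  by (rule fps_ext) (simp add: theta_sum_def sum.distrib)

lemma theta_sum_uminus: "theta_sum (\<lambda>k. - w k) e = - theta_sum w e"
  by (rule fps_ext) (simp add: theta_sum_def sum_negf)

lemma of_nat_theta_exp: "2 * int (theta_exp a b j) = a * (j * (j + 1)) + b * (j * (j - 1))"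
proof -
  have "2 * int (theta_exp a b j) = a * (2 * int (tri j)) + b * (2 * int (tri (- j)))"
    by (simp add: theta_exp_def)
  thus ?thesis unfolding of_nat_tri by (simp add: algebra_simps)
qed

section \<open>Dissections of E and of its cube\<close>

abbreviation euler :: "real fps" where "euler \<equiv> euler_prod {Suc 0..}"
abbreviation triple :: "real fps \<Rightarrow> real fps" where "triple F \<equiv> F oo fps_X ^ 3"

lemma arith_prog_iff: "0 < d \<Longrightarrow> n \<in> arith_prog a d \<longleftrightarrow> a \<le> n \<and> n mod d = a mod d"
  by (auto simp: arith_prog_def image_iff) (metis le_add_diff_inverse mod_eq_dvd_iff_nat dvdE mult.commute)

text \<open>The pentagonal number theorem: the three progressions of the triple product are the
  residue classes modulo 3 and together fill the positive integers.\<close>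

lemma theta_2_1: "theta_sum alt (theta_exp 2 1) = euler"
proof -
  have "{Suc 0..} = arith_prog 3 3 \<union> (arith_prog 2 3 \<union> arith_prog 1 3)"
    by (rule set_eqI) (simp add: arith_prog_iff, presburger)
  moreover have "arith_prog 3 3 \<inter> (arith_prog 2 3 \<union> arith_prog 1 3) = {}"
    "arith_prog 2 3 \<inter> arith_prog 1 3 = {}"
    by (auto simp: arith_prog_iff)
  ultimately show ?thesis
    using jacobi_triple_product[of 2 1] by (simp add: euler_prod_Un)
qed

lemma theta_1_2: "theta_sum alt (theta_exp 1 2) = euler"
proof -
  have "theta_exp 1 2 = (\<lambda>k. theta_exp 2 1 (- k))"
    by (simp add: theta_exp_def fun_eq_iff)
  thus ?thesis using theta_sum_reindex[of uminus alt "theta_exp 2 1"] theta_2_1 by simp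
qed

lemma alt_3 [simp]: "alt (3 * k) = alt k" "alt (3 * k + 1) = - alt k" "alt (3 * k - 1) = - alt k"
  by (simp_all add: alt_def)

text \<open>In the pentagonal series the index classes \<open>3k\<close>, \<open>3k + 1\<close>,
  \<open>3k - 1\<close> have exponents 0, 1, 2 modulo 3, so splitting the index also splits the
  exponents.\<close>

lemma euler_trisection:
  "euler = triple (theta_sum alt (theta_exp 4 5)) - fps_X * triple (theta_sum alt (theta_exp 7 2))
    - fps_X ^ 2 * triple (theta_sum alt (theta_exp 1 8))"
proof -
  have e: "theta_exp 1 2 (3 * k) = 0 + 3 * theta_exp 4 5 k"
    "theta_exp 1 2 (3 * k + 1) = 1 + 3 * theta_exp 7 2 k"
    "theta_exp 1 2 (3 * k - 1) = 2 + 3 * theta_exp 1 8 k" for k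
  proof -
    have "2 * int (theta_exp 1 2 (3 * k)) = 27 * k\<^sup>2 - 3 * k"
      "2 * int (theta_exp 1 2 (3 * k + 1)) = 27 * k\<^sup>2 + 15 * k + 2"
      "2 * int (theta_exp 1 2 (3 * k - 1)) = 27 * k\<^sup>2 - 21 * k + 4"
      "2 * int (theta_exp 4 5 k) = 9 * k\<^sup>2 - k"
      "2 * int (theta_exp 7 2 k) = 9 * k\<^sup>2 + 5 * k"
      "2 * int (theta_exp 1 8 k) = 9 * k\<^sup>2 - 7 * k"
      unfolding of_nat_theta_exp by (simp_all add: algebra_simps power2_eq_square)
    thus "theta_exp 1 2 (3 * k) = 0 + 3 * theta_exp 4 5 k"
      "theta_exp 1 2 (3 * k + 1) = 1 + 3 * theta_exp 7 2 k"
      "theta_exp 1 2 (3 * k - 1) = 2 + 3 * theta_exp 1 8 k" by linarith+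
  qed
  show ?thesis
    unfolding theta_1_2[symmetric]
    by (subst theta_sum_trisect, rule finite_theta_exp, simp)
      (simp only: e theta_sum_shift zero_less_numeral alt_3 theta_sum_uminus power_one_right power_0, simp)
qed

text \<open>By the pentagonal number theorem this is the sum of
  \<open>(-1)^j (6j + 1) X^(j(3j+1)/2)\<close>. Separating the derivative term makes the logarithmic
  derivative applicable.\<close>

definition theta_P :: "real fps" where
  "theta_P = euler + 6 * theta_sum (\<lambda>j. of_int j * alt j) (theta_exp 2 1)"

lemma triple_add: "triple (F + G) = triple F + triple G"
  by (rule fps_compose_add_distrib)

lemma triple_diff: "triple (F - G) = triple F - triple G"
  by (rule fps_compose_sub_distrib)

lemma triple_mult: "triple (F * G) = triple F * triple G"
  by (rule fps_compose_mult_distrib) simp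

lemma triple_power: "triple (F ^ n) = triple F ^ n"
  by (rule fps_compose_power [symmetric]) simp

lemma triple_numeral [simp]: "triple (numeral k) = numeral k"
  by (metis fps_const_compose numeral_fps_const)

lemma triple_X [simp]: "triple fps_X = fps_X ^ 3"
  by (rule fps_X_fps_compose_startby0) simp

text \<open>The reflection of j to \<open>-1 - j\<close> keeps the exponent and reverses the
  sign.\<close>

lemma theta_1_0_eq_0: "theta_sum alt (theta_exp 1 0) = 0"
proof -
  have "theta_exp 1 0 (- 1 - k) = theta_exp 1 0 k" for k
  proof -
    have "2 * int (theta_exp 1 0 (- 1 - k)) = 2 * int (theta_exp 1 0 k)"
      unfolding of_nat_theta_exp by (simp add: algebra_simps)
    thus ?thesis by linarith
  qed
  moreover have "alt (- 1 - k) = - alt k" for k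
    by (simp add: alt_def)
  ultimately have "theta_sum alt (theta_exp 1 0) = - theta_sum alt (theta_exp 1 0)"
    using theta_sum_reindex[of "\<lambda>k. - 1 - k" alt "theta_exp 1 0"] by (simp add: theta_sum_uminus)
  thus ?thesis by (simp add: eq_neg_iff_add_eq_0 flip: mult_2)
qed

text \<open>The indices \<open>3k\<close> and \<open>-3k - 1\<close> share an exponent divisible by
  3, and their weights add to \<open>6k + 1\<close> up to sign. At \<open>3k + 1\<close> the
  exponent is \<open>1 + 9 tri k\<close>; of the weight \<open>-(3k + 1)\<close> the constant part
  sums to 0, and the rest is Jacobi's series again.\<close>

lemma euler_cube_dissection: "euler ^ 3 = triple theta_P - 3 * fps_X * triple (triple euler ^ 3)"
proof -
  let ?w = "\<lambda>j. of_int j * alt j"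
  let ?e = "theta_exp 1 0"
  have e: "?e (3 * k) = 0 + 3 * theta_exp 2 1 k"
    "?e (3 * k + 1) = 1 + 3 * (0 + 3 * ?e k)"
    "?e (3 * (- k) - 1) = 0 + 3 * theta_exp 2 1 k" for k
  proof -
    have "2 * int (?e (3 * k)) = 9 * k\<^sup>2 + 3 * k"
      "2 * int (?e (3 * (- k) - 1)) = 9 * k\<^sup>2 + 3 * k"
      "2 * int (theta_exp 2 1 k) = 3 * k\<^sup>2 + k"
      unfolding of_nat_theta_exp by (simp_all add: algebra_simps power2_eq_square)
    thus "?e (3 * k) = 0 + 3 * theta_exp 2 1 k" "?e (3 * (- k) - 1) = 0 + 3 * theta_exp 2 1 k"
      by simp_all
    have "2 * int (?e (3 * k + 1)) = 9 * k\<^sup>2 + 9 * k + 2" "2 * int (?e k) = k\<^sup>2 + k"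
      unfolding of_nat_theta_exp by (simp_all add: algebra_simps power2_eq_square)
    hence "int (?e (3 * k + 1)) = int (1 + 3 * (0 + 3 * ?e k))" by simp
    thus "?e (3 * k + 1) = 1 + 3 * (0 + 3 * ?e k)" by (simp only: of_nat_eq_iff)
  qed
  let ?D = "theta_sum ?w (theta_exp 2 1)"
  have 0: "theta_sum (\<lambda>k. ?w (3 * k)) (\<lambda>k. ?e (3 * k)) = triple (3 * ?D)"
  proof -
    have "theta_sum (\<lambda>k. ?w (3 * k)) (theta_exp 2 1) = 3 * ?D"
      using theta_sum_cmult[of 3 ?w] by (simp add: mult.assoc numeral_fps_const)
    thus ?thesis unfolding e theta_sum_shift[OF zero_less_numeral] by simp
  qed
  have 1: "theta_sum (\<lambda>k. ?w (3 * k + 1)) (\<lambda>k. ?e (3 * k + 1)) = - (3 * fps_X * triple (triple euler ^ 3))"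
  proof -
    have "(\<lambda>k. ?w (3 * k + 1)) = (\<lambda>k. - (3 * ?w k + alt k))"
      by (rule ext) (simp only: alt_3, simp add: algebra_simps)
    hence "theta_sum (\<lambda>k. ?w (3 * k + 1)) ?e = - (3 * euler ^ 3)"
      by (simp only: theta_sum_uminus theta_sum_add theta_sum_cmult theta_1_0_eq_0 jacobi_cube)
        (simp add: numeral_fps_const)
    thus ?thesis unfolding e theta_sum_shift[OF zero_less_numeral]
      by (simp add: triple_mult triple_power fps_compose_uminus)
  qed
  have 2: "theta_sum (\<lambda>k. ?w (3 * k - 1)) (\<lambda>k. ?e (3 * k - 1)) = triple (3 * ?D + euler)"
  proof -
    have "theta_sum (\<lambda>k. ?w (3 * k - 1)) (\<lambda>k. ?e (3 * k - 1)) =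
        theta_sum (\<lambda>k. ?w (3 * (- k) - 1)) (\<lambda>k. ?e (3 * (- k) - 1))"
      by (rule theta_sum_reindex[symmetric, where p = uminus]) simp
    also have "(\<lambda>k. ?w (3 * (- k) - 1)) = (\<lambda>k. 3 * ?w k + alt k)"
      by (rule ext) (simp only: alt_3 alt_uminus, simp add: algebra_simps)
    also have "theta_sum \<dots> (\<lambda>k. ?e (3 * (- k) - 1)) = triple (3 * ?D + euler)"
      unfolding e theta_sum_shift[OF zero_less_numeral] theta_sum_add theta_sum_cmult theta_2_1
      by (simp add: numeral_fps_const)
    finally show ?thesis .
  qed
  have "euler ^ 3 = triple (3 * ?D) + - (3 * fps_X * triple (triple euler ^ 3)) + triple (3 * ?D + euler)"
    unfolding jacobi_cube by (subst theta_sum_trisect, rule finite_theta_exp, simp) (simp only: 0 1 2)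
  thus ?thesis by (simp add: theta_P_def triple_add triple_mult algebra_simps)
qed

section \<open>Sections modulo 3 and the multiplicative norm\<close>

definition fps_section :: "nat \<Rightarrow> real fps \<Rightarrow> real fps" where
  "fps_section r F = Abs_fps (\<lambda>n. F $ (3 * n + r))"

lemma fps_section_nth [simp]: "fps_section r F $ n = F $ (3 * n + r)"
  by (simp add: fps_section_def)

lemma trisection_nth:
  "(triple F + fps_X * triple G + fps_X ^ 2 * triple H) $ (3 * n) = F $ n"
  "(triple F + fps_X * triple G + fps_X ^ 2 * triple H) $ (3 * n + 1) = G $ n"
  "(triple F + fps_X * triple G + fps_X ^ 2 * triple H) $ (3 * n + 2) = H $ n"
proof -
  have "\<not> 3 dvd 3 * n + 2" "\<not> 3 dvd 3 * n + 1" "3 * n - 2 < 3 * n \<or> n = 0" by presburger+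
  moreover have "\<not> 3 dvd 3 * n - 1" "\<not> 3 dvd 3 * n - 2" if "n > 0" using that by presburger+
  ultimately show
  "(triple F + fps_X * triple G + fps_X ^ 2 * triple H) $ (3 * n) = F $ n"
  "(triple F + fps_X * triple G + fps_X ^ 2 * triple H) $ (3 * n + 1) = G $ n"
  "(triple F + fps_X * triple G + fps_X ^ 2 * triple H) $ (3 * n + 2) = H $ n"
    by (auto simp: fps_nth_compose_X_power fps_X_power_mult_nth)
qed

lemma section_trisection:
  "fps_section 0 (triple F + fps_X * triple G + fps_X ^ 2 * triple H) = F"
  "fps_section 1 (triple F + fps_X * triple G + fps_X ^ 2 * triple H) = G"
  "fps_section 2 (triple F + fps_X * triple G + fps_X ^ 2 * triple H) = H"
  by (rule fps_ext, simp only: fps_section_nth trisection_nth add_0_right)+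

lemma trisection:
  "F = triple (fps_section 0 F) + fps_X * triple (fps_section 1 F) + fps_X ^ 2 * triple (fps_section 2 F)"
proof (rule fps_ext)
  fix n :: nat
  have "n = 3 * (n div 3) \<or> n = 3 * (n div 3) + 1 \<or> n = 3 * (n div 3) + 2" by presburger
  then consider m where "n = 3 * m" | m where "n = 3 * m + 1" | m where "n = 3 * m + 2" by blast
  thus "F $ n = (triple (fps_section 0 F) + fps_X * triple (fps_section 1 F) +
      fps_X ^ 2 * triple (fps_section 2 F)) $ n"
    by cases (simp_all only: trisection_nth fps_section_nth add_0_right)
qed

text \<open>
  The norm to series in \<open>X\<^sup>3\<close>, with \<open>X\<^sup>3\<close> then replaced by \<open>X\<close>: the product of
  \<open>F(\<omega>\<^sup>j X)\<close> over \<open>j < 3\<close>, expanded so as to avoid the cube root of unity \<open>\<omega>\<close>.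
\<close>

definition norm3 :: "real fps \<Rightarrow> real fps" where
  "norm3 F = fps_section 0 F ^ 3 + fps_X * fps_section 1 F ^ 3 + fps_X ^ 2 * fps_section 2 F ^ 3
     - 3 * fps_X * fps_section 0 F * fps_section 1 F * fps_section 2 F"

lemma norm3_trisection:
  "norm3 (triple F + fps_X * triple G + fps_X ^ 2 * triple H) =
    F ^ 3 + fps_X * G ^ 3 + fps_X ^ 2 * H ^ 3 - 3 * fps_X * F * G * H"
  unfolding norm3_def section_trisection ..

text \<open>Products of sections whose residues add to 3 or more wrap around with a factor
  \<open>X ^ 3\<close>, which is X inside \<open>triple\<close>. Multiplicativity is then a
  polynomial identity in the six sections and X.\<close>

lemma norm3_mult: "norm3 (F * G) = norm3 F * norm3 G"
proof -
  define a b c where "a = fps_section 0 F" and "b = fps_section 1 F" and "c = fps_section 2 F"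
  define x y z where "x = fps_section 0 G" and "y = fps_section 1 G" and "z = fps_section 2 G"
  have "F * G = triple (a * x + fps_X * (b * z + c * y)) + fps_X * triple (a * y + b * x + fps_X * (c * z))
      + fps_X ^ 2 * triple (a * z + b * y + c * x)"
    by (subst trisection[of F], subst trisection[of G], fold a_def b_def c_def x_def y_def z_def)
      (simp only: triple_add triple_mult triple_X, algebra)
  hence "norm3 (F * G) = (a * x + fps_X * (b * z + c * y)) ^ 3 + fps_X * (a * y + b * x + fps_X * (c * z)) ^ 3
     + fps_X ^ 2 * (a * z + b * y + c * x) ^ 3
     - 3 * fps_X * (a * x + fps_X * (b * z + c * y)) * (a * y + b * x + fps_X * (c * z)) * (a * z + b * y + c * x)"
    by (simp only: norm3_trisection)
  also have "\<dots> = (a ^ 3 + fps_X * b ^ 3 + fps_X ^ 2 * c ^ 3 - 3 * fps_X * a * b * c) *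
      (x ^ 3 + fps_X * y ^ 3 + fps_X ^ 2 * z ^ 3 - 3 * fps_X * x * y * z)"
    by algebra
  finally show ?thesis by (simp add: norm3_def a_def b_def c_def x_def y_def z_def)
qed

lemma norm3_triple: "norm3 (triple F) = F ^ 3"
  using norm3_trisection[of F 0 0] by simp

text \<open>The product of \<open>1 - (\<omega>^j X)^k\<close> over the cube roots of unity is
  \<open>(1 - X^k)^3\<close> if 3 divides k and \<open>1 - X^(3k)\<close> otherwise; then
  \<open>X^3\<close> is replaced by X.\<close>

lemma norm3_one_minus_X_power:
  "norm3 (1 - fps_X ^ (3 * l)) = (1 - fps_X ^ l) ^ 3"
  "norm3 (1 - fps_X ^ (3 * l + 1)) = 1 - fps_X ^ (3 * l + 1)"
  "norm3 (1 - fps_X ^ (3 * l + 2)) = 1 - fps_X ^ (3 * l + 2)"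
proof -
  have "(1 - fps_X ^ (3 * l) :: real fps) = triple (1 - fps_X ^ l)"
    by (simp add: triple_diff triple_power power_mult)
  thus "norm3 (1 - fps_X ^ (3 * l)) = (1 - fps_X ^ l) ^ 3"
    by (simp only: norm3_triple)
  have neg: "(- (fps_X ^ l)) ^ 3 = - (fps_X ^ (3 * l) :: real fps)"
    by (simp add: mult.commute flip: power_mult)
  have "(1 - fps_X ^ (3 * l + 1) :: real fps) = triple 1 + fps_X * triple (- (fps_X ^ l)) + fps_X ^ 2 * triple 0"
    by (simp add: fps_compose_uminus triple_power power_mult power_add)
  hence "norm3 (1 - fps_X ^ (3 * l + 1)) = 1 + fps_X * (- (fps_X ^ l)) ^ 3"
    by (simp only: norm3_trisection) simp
  thus "norm3 (1 - fps_X ^ (3 * l + 1)) = 1 - fps_X ^ (3 * l + 1)"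
    by (simp only: neg) (simp add: power_add)
  have "(1 - fps_X ^ (3 * l + 2) :: real fps) = triple 1 + fps_X * triple 0 + fps_X ^ 2 * triple (- (fps_X ^ l))"
    by (simp add: fps_compose_uminus triple_power add.commute flip: power_mult power_add)
  hence "norm3 (1 - fps_X ^ (3 * l + 2)) = 1 + fps_X ^ 2 * (- (fps_X ^ l)) ^ 3"
    by (simp only: norm3_trisection) simp
  thus "norm3 (1 - fps_X ^ (3 * l + 2)) = 1 - fps_X ^ (3 * l + 2)"
    unfolding neg power_add
    by (simp only: mult_minus_right mult.commute[of "fps_X ^ 2"] add_uminus_conv_diff)
qed

lemma fps_section_cong: "r < 3 \<Longrightarrow> fps_cong (3 * N) F G \<Longrightarrow> fps_cong N (fps_section r F) (fps_section r G)"
  by (auto simp: fps_cong_def)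

lemma norm3_cong: "fps_cong (3 * N) F G \<Longrightarrow> fps_cong N (norm3 F) (norm3 G)"
  unfolding norm3_def
  by (intro fps_cong_add fps_cong_diff fps_cong_mult fps_cong_power fps_cong_refl fps_section_cong) auto

text \<open>Under the norm, factors with index prime to 3 are fixed and the factor of index 3k
  becomes \<open>(1 - X^k)^3\<close>. Multiplication by \<open>triple\<close> restores the missing
  factors \<open>1 - X^(3k)\<close>.\<close>

lemma norm3_partial_euler:
  "norm3 (partial_euler {Suc 0..} (3 * n)) * triple (partial_euler {Suc 0..} n) =
    partial_euler {Suc 0..} (3 * n) * partial_euler {Suc 0..} n ^ 3"
proof (induction n)
  case 0
  have "norm3 1 = 1" using norm3_triple[of 1] by simp
  thus ?case by simp
next
  case (Suc n)
  let ?p = "\<lambda>k. 1 - fps_X ^ k :: real fps" and ?e = "partial_euler {Suc 0..}"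
  have e: "?e (3 * Suc n) = ?p (3 * n + 1) * ?p (3 * n + 2) * ?p (3 * Suc n) * ?e (3 * n)"
    by (simp add: partial_euler_Suc eval_nat_numeral mult_ac del: power_Suc)
  have N: "norm3 (?e (3 * Suc n)) = ?p (3 * n + 1) * ?p (3 * n + 2) * ?p (Suc n) ^ 3 * norm3 (?e (3 * n))"
    unfolding e norm3_mult norm3_one_minus_X_power ..
  have E: "?e (Suc n) = ?p (Suc n) * ?e n" by (simp add: partial_euler_Suc)
  have T: "triple (?p (Suc n)) = ?p (3 * Suc n)"
    by (simp add: triple_diff triple_power power_mult del: power_Suc mult_Suc_right)
  have "norm3 (?e (3 * Suc n)) * triple (?e (Suc n)) =
      ?p (3 * n + 1) * ?p (3 * n + 2) * ?p (3 * Suc n) * ?p (Suc n) ^ 3 * (norm3 (?e (3 * n)) * triple (?e n))"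
    unfolding N E triple_mult T by (simp only: mult_ac)
  also have "\<dots> = ?e (3 * Suc n) * ?e (Suc n) ^ 3"
    unfolding Suc.IH e E power_mult_distrib by (simp only: mult_ac)
  finally show ?case .
qed

lemma norm3_euler: "norm3 euler * triple euler = euler ^ 4"
proof (rule fps_cong_imp_eq)
  fix N :: nat
  have "fps_cong N (norm3 euler * triple euler) (norm3 (partial_euler {Suc 0..} (3 * N)) * triple (partial_euler {Suc 0..} N))"
    by (intro fps_cong_mult norm3_cong fps_cong_compose_X_power euler_prod_cong) auto
  also have "\<dots> = partial_euler {Suc 0..} (3 * N) * partial_euler {Suc 0..} N ^ 3"
    by (rule norm3_partial_euler)
  also have "fps_cong N \<dots> (euler * euler ^ 3)"
    by (intro fps_cong_mult fps_cong_power fps_cong_sym[OF euler_prod_cong]) auto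
  finally show "fps_cong N (norm3 euler * triple euler) (euler ^ 4)"
    by (simp add: eval_nat_numeral)
qed

text \<open>The norm of the cube of E is computed twice: from the dissection, which has no class 2,
  and by multiplicativity.\<close>

lemma theta_P_cube:
  "(theta_P ^ 3 - 27 * fps_X * triple euler ^ 9) * triple euler ^ 3 = euler ^ 12"
proof -
  have "euler ^ 3 = triple theta_P + fps_X * triple (- 3 * triple euler ^ 3) + fps_X ^ 2 * triple 0"
    unfolding euler_cube_dissection by (simp add: triple_mult fps_compose_uminus mult_ac)
  hence "norm3 (euler ^ 3) = theta_P ^ 3 + fps_X * (- 3 * triple euler ^ 3) ^ 3"
    by (simp only: norm3_trisection) simp
  also have "\<dots> = theta_P ^ 3 - 27 * fps_X * triple euler ^ 9"
    by (simp add: power_mult_distrib flip: power_mult)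
  finally have "norm3 euler ^ 3 = theta_P ^ 3 - 27 * fps_X * triple euler ^ 9"
    by (simp add: power3_eq_cube norm3_mult)
  moreover have "(norm3 euler * triple euler) ^ 3 = euler ^ 12"
    by (simp add: norm3_euler flip: power_mult)
  ultimately show ?thesis by (simp add: power_mult_distrib)
qed

section \<open>Nonnegative power series\<close>

definition fps_nonneg :: "real fps \<Rightarrow> bool" where
  "fps_nonneg F \<longleftrightarrow> (\<forall>n. 0 \<le> F $ n)"

definition fps_pos :: "real fps \<Rightarrow> bool" where
  "fps_pos F \<longleftrightarrow> (\<forall>n. 0 < F $ n)"

lemma fps_pos_imp_nonneg: "fps_pos F \<Longrightarrow> fps_nonneg F"
  by (auto simp: fps_pos_def fps_nonneg_def less_imp_le)

lemma fps_nonneg_one [simp]: "fps_nonneg 1"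
  by (simp add: fps_nonneg_def)

lemma fps_nonneg_X_power [simp]: "fps_nonneg (fps_X ^ k)"
  by (simp add: fps_nonneg_def)

lemma fps_nonneg_mult: "fps_nonneg F \<Longrightarrow> fps_nonneg G \<Longrightarrow> fps_nonneg (F * G)"
  by (simp add: fps_nonneg_def fps_mult_nth sum_nonneg)

lemma fps_nonneg_sum: "(\<And>i. i \<in> I \<Longrightarrow> fps_nonneg (F i)) \<Longrightarrow> fps_nonneg (sum F I)"
  by (simp add: fps_nonneg_def fps_sum_nth sum_nonneg)

lemma fps_nonneg_power: "fps_nonneg F \<Longrightarrow> fps_nonneg (F ^ n)"
  by (induction n) (simp_all add: fps_nonneg_mult)

lemma fps_nonneg_compose_X_power: "0 < m \<Longrightarrow> fps_nonneg F \<Longrightarrow> fps_nonneg (F oo fps_X ^ m)"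
  by (simp add: fps_nonneg_def fps_nth_compose_X_power)

lemma fps_nonneg_cong_limit:
  assumes "\<And>N. \<exists>G. fps_nonneg G \<and> fps_cong N F G"
  shows "fps_nonneg F"
  unfolding fps_nonneg_def
proof
  fix n :: nat
  obtain G where "fps_nonneg G" "fps_cong (Suc n) F G" using assms by blast
  thus "0 \<le> F $ n" by (simp add: fps_nonneg_def fps_cong_def)
qed

lemma fps_pos_mult:
  assumes "fps_pos F" "fps_nonneg G" "0 < G $ 0"
  shows "fps_pos (F * G)"
  unfolding fps_pos_def
proof
  fix n :: nat
  have "0 < F $ n * G $ (n - n)" using assms by (simp add: fps_pos_def)
  also have "\<dots> \<le> (\<Sum>i=0..n. F $ i * G $ (n - i))"
    by (rule member_le_sum) (use assms in \<open>auto simp: fps_pos_def fps_nonneg_def less_imp_le\<close>)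
  finally show "0 < (F * G) $ n" by (simp add: fps_mult_nth)
qed

lemma inverse_one_minus_X: "inverse (1 - fps_X :: real fps) = Abs_fps (\<lambda>_. 1)"
  by (metis fps_inverse_gp' fps_inverse_idempotent fps_nth_Abs_fps one_neq_zero)

lemma fps_pos_inverse_one_minus_X: "fps_pos (inverse (1 - fps_X))"
  by (simp add: inverse_one_minus_X fps_pos_def)

lemma fps_nonneg_inverse_one_minus_X_power:
  assumes "0 < k" shows "fps_nonneg (inverse (1 - fps_X ^ k))"
proof -
  have "inverse (1 - fps_X ^ k :: real fps) = inverse (1 - fps_X) oo fps_X ^ k"
    using assms by (simp add: fps_inverse_compose fps_compose_sub_distrib fps_X_fps_compose_startby0)
  thus ?thesis
    using assms fps_pos_inverse_one_minus_X
    by (simp add: fps_nonneg_compose_X_power fps_pos_imp_nonneg)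
qed

section \<open>Reciprocals and quotients of Euler products\<close>

lemma fps_nonneg_inverse_euler_prod: "fps_nonneg (inverse (euler_prod S))"
proof (rule fps_nonneg_cong_limit)
  fix N :: nat
  have "fps_nonneg (inverse (partial_euler S n))" for n
    by (induction n) (simp_all add: partial_euler_Suc fps_inverse_mult fps_nonneg_mult
       fps_nonneg_inverse_one_minus_X_power del: power_Suc)
  moreover have "fps_cong N (inverse (euler_prod S)) (inverse (partial_euler S N))"
    by (intro fps_cong_inverse euler_prod_cong) auto
  ultimately show "\<exists>G. fps_nonneg G \<and> fps_cong N (inverse (euler_prod S)) G" by blast
qed

lemma euler_prod_times_inverse: "euler_prod S * inverse (euler_prod S) = 1"
  by (rule inverse_mult_eq_1') simp

lemma euler_prod_subset_quotient:
  assumes "S \<subseteq> T"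
  shows "euler_prod S * inverse (euler_prod T) = inverse (euler_prod (T - S))"
proof -
  have "euler_prod T = euler_prod S * euler_prod (T - S)"
    using euler_prod_Un[of S "T - S"] assms by (simp add: Un_absorb1)
  hence "euler_prod S * inverse (euler_prod T) =
      (euler_prod S * inverse (euler_prod S)) * inverse (euler_prod (T - S))"
    by (simp add: fps_inverse_mult mult_ac)
  thus ?thesis by (simp add: euler_prod_times_inverse)
qed

text \<open>Isolates \<open>1 / (1 - X)\<close>, whose coefficients are all positive and which also
  compensates the signs in the Lambert series of \<open>theta_P\<close>.\<close>

lemma inverse_euler_factor: "inverse euler = inverse (1 - fps_X) * inverse (euler_prod {2..})"
proof -
  have "euler_prod {1} = 1 - fps_X"
  proof (rule fps_cong_imp_eq)
    fix N :: nat show "fps_cong N (euler_prod {1}) (1 - fps_X)"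
      using prod_cong_euler_prod[of "{1}" "{1}" N] by (simp add: fps_cong_sym)
  qed
  moreover have "{Suc 0..} = {1} \<union> {2..}" by auto
  hence "euler = euler_prod {1} * euler_prod {2..}"
    using euler_prod_Un[of "{1}" "{2..}"] by simp
  ultimately show ?thesis by (simp add: fps_inverse_mult)
qed

lemma fps_pos_inverse_euler: "fps_pos (inverse euler)"
  unfolding inverse_euler_factor
  by (intro fps_pos_mult fps_pos_inverse_one_minus_X fps_nonneg_inverse_euler_prod) simp

lemma fps_pos_inverse_euler_power: "0 < n \<Longrightarrow> fps_pos (inverse euler ^ n)"
proof (induction n rule: nat_induct_non_zero)
  case (Suc n)
  thus ?case using fps_pos_mult[OF fps_pos_inverse_euler, of "inverse euler ^ n"]
    by (simp add: fps_pos_imp_nonneg fps_pos_def[of "_ ^ _"])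
qed (simp add: fps_pos_inverse_euler)

lemma triple_euler: "triple euler = euler_prod (arith_prog 3 3)"
proof -
  have "(*) 3 ` {Suc 0..} = arith_prog 3 3"
  proof (intro equalityI subsetI)
    fix x assume "x \<in> (*) 3 ` {Suc 0..}"
    then obtain y where "x = 3 * y" "1 \<le> y" by auto
    hence "x = 3 + (y - 1) * 3" by simp
    thus "x \<in> arith_prog 3 3" unfolding arith_prog_def by blast
  next
    fix x assume "x \<in> arith_prog 3 3"
    then obtain k where "x = 3 * Suc k" by (auto simp: arith_prog_def)
    thus "x \<in> (*) 3 ` {Suc 0..}" by blast
  qed
  thus ?thesis by (simp add: euler_prod_compose)
qed

lemma
  shows fps_nonneg_triple_euler_quotient: "fps_nonneg (triple euler * inverse euler)"
    and triple_euler_quotient_nth_0: "(triple euler * inverse euler) $ 0 = 1"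
proof -
  have "triple euler * inverse euler = inverse (euler_prod ({Suc 0..} - arith_prog 3 3))"
    unfolding triple_euler by (rule euler_prod_subset_quotient) (auto simp: arith_prog_iff)
  thus "fps_nonneg (triple euler * inverse euler)" "(triple euler * inverse euler) $ 0 = 1"
    by (simp_all add: fps_nonneg_inverse_euler_prod)
qed

text \<open>For \<open>a \<noteq> b\<close> the three progressions are disjoint sets of positive
  integers, so the theta product divides E and the quotient is the reciprocal of the leftover
  factors.\<close>

lemma fps_nonneg_theta_quotient:
  assumes "0 < a" "0 < b" "a \<noteq> b"
  shows "fps_nonneg (theta_sum alt (theta_exp a b) * inverse euler)"
    and "(theta_sum alt (theta_exp a b) * inverse euler) $ 0 = 1"
proof -
  let ?d = "a + b"
  let ?S = "arith_prog ?d ?d \<union> (arith_prog a ?d \<union> arith_prog b ?d)"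
  have "arith_prog ?d ?d \<inter> (arith_prog a ?d \<union> arith_prog b ?d) = {}"
    "arith_prog a ?d \<inter> arith_prog b ?d = {}"
    using assms by (auto simp: arith_prog_iff)
  hence "theta_sum alt (theta_exp a b) = euler_prod ?S"
    using assms by (simp add: jacobi_triple_product euler_prod_Un)
  moreover have "?S \<subseteq> {Suc 0..}"
    using assms by (auto simp: arith_prog_iff)
  ultimately have "theta_sum alt (theta_exp a b) * inverse euler = inverse (euler_prod ({Suc 0..} - ?S))"
    by (simp only: euler_prod_subset_quotient)
  thus "fps_nonneg (theta_sum alt (theta_exp a b) * inverse euler)"
    "(theta_sum alt (theta_exp a b) * inverse euler) $ 0 = 1"
    by (simp_all add: fps_nonneg_inverse_euler_prod)
qed

section \<open>Sign patterns\<close>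

text \<open>With \<open>u = X ^ Suc k\<close> the difference
  \<open>u/(1 - u) - X u/(1 - X u)\<close> equals \<open>u (1 - X) / ((1 - u)(1 - X u))\<close>, and
  the factor \<open>1 - X\<close> cancels.\<close>

lemma log_derivative_term_nonneg:
  "fps_nonneg (inverse (1 - fps_X) *
    (fps_X ^ Suc k * inverse (1 - fps_X ^ Suc k) - fps_X ^ Suc (Suc k) * inverse (1 - fps_X ^ Suc (Suc k))))"
proof -
  define u :: "real fps" where "u = fps_X ^ Suc k"
  define v w z where "v = inverse (1 - u)" and "w = inverse (1 - fps_X * u)"
    and "z = inverse (1 - fps_X :: real fps)"
  have u: "(1 - u) * v = 1" and w: "(1 - fps_X * u) * w = 1" and z: "(1 - fps_X) * z = 1"
    unfolding v_def w_def z_def by (rule inverse_mult_eq_1'; simp add: u_def)+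
  have "z * (u * v - (fps_X * u) * w) =
      z * (u * v * ((1 - fps_X * u) * w) - (fps_X * u) * w * ((1 - u) * v))"
    by (simp only: u w mult_1_right)
  also have "\<dots> = u * v * w * ((1 - fps_X) * z)"
    by (simp add: algebra_simps)
  finally have "z * (u * v - (fps_X * u) * w) = u * v * w"
    by (simp only: z mult_1_right)
  moreover have "fps_nonneg (u * v * w)"
    unfolding v_def w_def u_def power_Suc[of fps_X "Suc k", symmetric]
    by (intro fps_nonneg_mult fps_nonneg_X_power fps_nonneg_inverse_one_minus_X_power zero_less_Suc)
  ultimately show ?thesis by (simp add: u_def v_def w_def z_def)
qed

text \<open>With \<open>D\<close> the derivative series, \<open>P / E^2 = 1/E + 6 D / E^2\<close>,
  and modulo any power of X the last quotient is \<open>L / E\<close>. The factor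
  \<open>1 / (1 - X)\<close> of \<open>1/E\<close> makes each term of \<open>L\<close>
  nonnegative.\<close>

lemma
  shows fps_nonneg_theta_P_quotient: "fps_nonneg (theta_P * inverse euler ^ 2)"
    and theta_P_quotient_nth_0: "(theta_P * inverse euler ^ 2) $ 0 = 1"
proof -
  define D where "D = theta_sum (\<lambda>j. of_int j * alt j) (theta_exp 2 1)"
  define L :: "nat \<Rightarrow> real fps" where
    "L n = (\<Sum>k<n. fps_X ^ (1 + k * 3) * inverse (1 - fps_X ^ (1 + k * 3)) -
              fps_X ^ (2 + k * 3) * inverse (1 - fps_X ^ (2 + k * 3)))" for n
  have D: "fps_cong N D (euler * L (2 * N))" for N
    using theta_derivative_cong[of 2 1 N "2 * N", unfolded theta_2_1] by (simp add: D_def L_def)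
  have P: "theta_P * inverse euler ^ 2 = inverse euler + 6 * (D * inverse euler ^ 2)"
    using euler_prod_times_inverse[of "{Suc 0..}"]
    by (simp add: theta_P_def D_def algebra_simps power2_eq_square)
  have "fps_nonneg (inverse (1 - fps_X) * L n)" for n
    unfolding L_def sum_distrib_left
    by (intro fps_nonneg_sum) (use log_derivative_term_nonneg in \<open>simp add: numeral_2_eq_2\<close>)
  hence L: "fps_nonneg (inverse euler * L n)" for n
    using fps_nonneg_mult[OF fps_nonneg_inverse_euler_prod[of "{2..}"], of "inverse (1 - fps_X) * L n"]
    by (simp add: inverse_euler_factor mult_ac)
  have "fps_nonneg (D * inverse euler ^ 2)"
  proof (rule fps_nonneg_cong_limit, intro exI conjI)
    fix N :: nat
    have "fps_cong N (D * inverse euler ^ 2) (euler * L (2 * N) * inverse euler ^ 2)"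
      by (intro fps_cong_mult D fps_cong_refl)
    also have "euler * L (2 * N) * inverse euler ^ 2 =
        (euler * inverse euler) * (inverse euler * L (2 * N))"
      by (simp add: power2_eq_square mult_ac)
    also have "\<dots> = inverse euler * L (2 * N)" by (simp only: euler_prod_times_inverse mult_1_left)
    finally show "fps_cong N (D * inverse euler ^ 2) (inverse euler * L (2 * N))" .
    show "fps_nonneg (inverse euler * L (2 * N))" by (rule L)
  qed
  thus "fps_nonneg (theta_P * inverse euler ^ 2)"
    unfolding P using fps_pos_imp_nonneg[OF fps_pos_inverse_euler]
    by (auto simp: fps_nonneg_def)
  have "D $ 0 = 0"
    using D[of 1] by (simp add: fps_cong_def L_def fps_sum_nth)
  thus "(theta_P * inverse euler ^ 2) $ 0 = 1" unfolding P by simp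
qed


section \<open>The three residue classes of the quotient\<close>

text \<open>Cubing the two-term dissection produces X to the powers 0, 1, 2, 3; the first and last
  fall into class 0, the others are classes 1 and 2.\<close>

lemma quotient_trisection:
  assumes F: "F * triple euler ^ i = euler ^ 9"
  shows "F = triple ((theta_P ^ 3 - 27 * fps_X * triple euler ^ 9) * inverse euler ^ i)
    + fps_X * triple (- 9 * (theta_P ^ 2 * triple euler ^ 3 * inverse euler ^ i))
    + fps_X ^ 2 * triple (27 * (theta_P * triple euler ^ 6 * inverse euler ^ i))"
proof -
  define J where "J = inverse euler ^ i"
  define T where "T = triple euler"
  have "triple euler * triple (inverse euler) = 1"
    using euler_prod_times_inverse[of "{Suc 0..}"] by (metis triple_mult fps_compose_1)
  hence "triple euler ^ i * triple J = 1"
    by (simp add: J_def triple_power flip: power_mult_distrib)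
  hence "F = euler ^ 9 * triple J"
    by (simp add: mult.assoc flip: F)
  also have "euler ^ 9 = (euler ^ 3) ^ 3" by (simp flip: power_mult)
  also have "\<dots> = (triple theta_P - 3 * fps_X * triple (T ^ 3)) ^ 3"
    by (simp only: euler_cube_dissection T_def)
  also have "\<dots> * triple J = triple ((theta_P ^ 3 - 27 * fps_X * T ^ 9) * J)
    + fps_X * triple (- 9 * (theta_P ^ 2 * T ^ 3 * J))
    + fps_X ^ 2 * triple (27 * (theta_P * T ^ 6 * J))"
  proof -
    have expand: "(p - 3 * x * s) ^ 3 * j = (p ^ 3 - 27 * x ^ 3 * s ^ 3) * j
      + x * (- 9 * (p ^ 2 * s * j)) + x ^ 2 * (27 * (p * s ^ 2 * j))" for p x s j :: "real fps"
      by (simp add: power2_eq_square power3_eq_cube algebra_simps)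
    have T: "T ^ 9 = (T ^ 3) ^ 3" "T ^ 6 = (T ^ 3) ^ 2" by (simp_all flip: power_mult)
    show ?thesis
      unfolding expand T
      by (simp only: triple_add triple_diff triple_mult triple_power triple_X triple_numeral
        fps_compose_uminus)
  qed
  finally show ?thesis by (simp add: J_def T_def)
qed

lemma fps_pos_class_1:
  assumes "11 \<le> i"
  shows "fps_pos (theta_P ^ 2 * triple euler ^ 3 * inverse euler ^ i)"
proof -
  define K R where "K = triple euler * inverse euler" and "R = theta_P * inverse euler ^ 2"
  have K: "fps_nonneg K" "K $ 0 = 1" and R: "fps_nonneg R" "R $ 0 = 1"
    unfolding K_def R_def
    by (rule fps_nonneg_triple_euler_quotient triple_euler_quotient_nth_0
        fps_nonneg_theta_P_quotient theta_P_quotient_nth_0)+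
  \<comment> \<open>\<open>K ^ 3 * R ^ 2\<close> uses 3 + 4 = 7 reciprocals of E; at least one
    remains, which gives strict positivity.\<close>
  obtain k where i: "i = k + 7" "0 < k"
    using assms by (intro that[of "i - 7"]) auto
  have "inverse euler ^ i = inverse euler ^ k * inverse euler ^ 3 * (inverse euler ^ 2) ^ 2"
    unfolding i by (simp add: add.commute flip: power_add power_mult)
  hence "theta_P ^ 2 * triple euler ^ 3 * inverse euler ^ i = inverse euler ^ k *
      (K ^ 3 * R ^ 2)"
    by (simp only: K_def R_def power_mult_distrib mult_ac)
  also have "fps_pos \<dots>"
    using i by (intro fps_pos_mult fps_pos_inverse_euler_power fps_nonneg_mult fps_nonneg_power
        K(1) R(1)) (simp_all add: fps_power_zeroth K(2) R(2))
  finally show ?thesis .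
qed

lemma fps_pos_class_2:
  assumes "11 \<le> i"
  shows "fps_pos (theta_P * triple euler ^ 6 * inverse euler ^ i)"
proof -
  define K R where "K = triple euler * inverse euler" and "R = theta_P * inverse euler ^ 2"
  have K: "fps_nonneg K" "K $ 0 = 1" and R: "fps_nonneg R" "R $ 0 = 1"
    unfolding K_def R_def
    by (rule fps_nonneg_triple_euler_quotient triple_euler_quotient_nth_0
        fps_nonneg_theta_P_quotient theta_P_quotient_nth_0)+
  \<comment> \<open>Here \<open>K ^ 6 * R\<close> uses 6 + 2 = 8 reciprocals of E.\<close>
  obtain k where i: "i = k + 8" "0 < k"
    using assms by (intro that[of "i - 8"]) auto
  have "inverse euler ^ i = inverse euler ^ k * inverse euler ^ 6 * inverse euler ^ 2"
    unfolding i by (simp add: add.commute flip: power_add)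
  hence "theta_P * triple euler ^ 6 * inverse euler ^ i = inverse euler ^ k *
      (K ^ 6 * R)"
    by (simp only: K_def R_def power_mult_distrib mult_ac)
  also have "fps_pos \<dots>"
    using i by (intro fps_pos_mult fps_pos_inverse_euler_power fps_nonneg_mult fps_nonneg_power
        K(1) R(1)) (simp_all add: fps_power_zeroth K(2) R(2))
  finally show ?thesis .
qed

lemma class_0_eq:
  "(theta_P ^ 3 - 27 * fps_X * triple euler ^ 9) * inverse euler ^ i =
    euler ^ 12 * inverse euler ^ i * triple (inverse euler ^ 3)"
proof -
  have "triple euler * triple (inverse euler) = 1"
    using euler_prod_times_inverse[of "{Suc 0..}"] by (metis triple_mult fps_compose_1)
  hence T: "triple euler ^ 3 * triple (inverse euler ^ 3) = 1"
    by (simp add: triple_power flip: power_mult_distrib)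
  have "euler ^ 12 * triple (inverse euler ^ 3) =
      (theta_P ^ 3 - 27 * fps_X * triple euler ^ 9) * (triple euler ^ 3 * triple (inverse euler ^ 3))"
    by (simp only: mult.assoc flip: theta_P_cube)
  thus ?thesis unfolding T by (simp add: mult_ac)
qed

lemma fps_pos_class_0:
  assumes "12 < i"
  shows "fps_pos (euler ^ 12 * inverse euler ^ i * triple (inverse euler ^ 3))"
proof -
  obtain k where i: "i = 12 + k" "0 < k"
    using assms by (intro that[of "i - 12"]) auto
  have "euler ^ 12 * inverse euler ^ i = (euler * inverse euler) ^ 12 * inverse euler ^ k"
    unfolding i by (simp only: power_add power_mult_distrib mult.assoc)
  also have "\<dots> = inverse euler ^ k"
    by (simp only: euler_prod_times_inverse power_one mult_1_left)
  finally show ?thesis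
    using i by (auto intro!: fps_pos_mult fps_pos_inverse_euler_power fps_nonneg_compose_X_power
       fps_nonneg_power fps_nonneg_inverse_euler_prod simp: fps_compose_nth_0 fps_power_zeroth)
qed

text \<open>What remains is a series in \<open>X ^ 3\<close>, hence the zero coefficients at n
  congruent to 3 and 6 modulo 9.\<close>

lemma class_0_12:
  "euler ^ 12 * inverse euler ^ 12 * triple (inverse euler ^ 3) = triple (inverse euler ^ 3)"
proof -
  have "euler ^ 12 * inverse euler ^ 12 = (euler * inverse euler) ^ 12"
    by (simp only: power_mult_distrib)
  thus ?thesis by (simp only: euler_prod_times_inverse power_one mult_1_left)
qed

text \<open>One factor E survives, and the signs of its pentagonal trisection separate n congruent
  to 0 from 3 and 6 modulo 9.\<close>

lemma class_0_11:
  "euler ^ 12 * inverse euler ^ 11 * triple (inverse euler ^ 3) =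
    triple (theta_sum alt (theta_exp 4 5) * inverse euler ^ 3)
    + fps_X * triple (- (theta_sum alt (theta_exp 7 2) * inverse euler ^ 3))
    + fps_X ^ 2 * triple (- (theta_sum alt (theta_exp 1 8) * inverse euler ^ 3))"
proof -
  have "euler ^ 12 * inverse euler ^ 11 = (euler * inverse euler) ^ 11 * euler"
    using power_add[of euler 11 1] by (simp only: power_mult_distrib mult_ac) (simp add: mult_ac)
  hence "euler ^ 12 * inverse euler ^ 11 = euler"
    by (simp only: euler_prod_times_inverse power_one mult_1_left)
  hence "euler ^ 12 * inverse euler ^ 11 * triple (inverse euler ^ 3) =
    (triple (theta_sum alt (theta_exp 4 5)) - fps_X * triple (theta_sum alt (theta_exp 7 2))
    - fps_X ^ 2 * triple (theta_sum alt (theta_exp 1 8))) * triple (inverse euler ^ 3)"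
    by (simp only: euler_trisection[symmetric])
  thus ?thesis
    by (simp only: triple_mult fps_compose_uminus) (simp add: algebra_simps)
qed

lemma fps_pos_theta_quotient:
  assumes "0 < a" "0 < b" "a \<noteq> b"
  shows "fps_pos (theta_sum alt (theta_exp a b) * inverse euler ^ 3)"
proof -
  have "theta_sum alt (theta_exp a b) * inverse euler ^ 3 =
      inverse euler ^ 2 * (theta_sum alt (theta_exp a b) * inverse euler)"
    by (simp only: power3_eq_cube power2_eq_square mult_ac)
  also have "fps_pos \<dots>"
    using fps_nonneg_theta_quotient[OF assms] by (intro fps_pos_mult fps_pos_inverse_euler_power) auto
  finally show ?thesis .
qed

theorem theorem1p3:
  fixes i :: nat and a :: "nat \<Rightarrow> real"
  assumes hi: "i \<ge> 11"
    and ha: "\<And>q::real. \<bar>q\<bar> < 1 \<Longrightarrow>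
      (\<lambda>n. a n * q ^ n) sums (qpoch_inf q q ^ 9 / qpoch_inf (q ^ 3) (q ^ 3) ^ i)"
  shows "(i = 11 \<longrightarrow> (\<forall>n. (n mod 9 \<in> {0, 2, 5, 8} \<longrightarrow> a n > 0) \<and>
                              (n mod 9 \<notin> {0, 2, 5, 8} \<longrightarrow> a n < 0)))
       \<and> (i = 12 \<longrightarrow> (\<forall>n. (n mod 9 \<in> {0, 2, 5, 8} \<longrightarrow> a n > 0) \<and>
                              (n mod 9 \<in> {1, 4, 7} \<longrightarrow> a n < 0) \<and>
                              (n mod 9 \<in> {3, 6} \<longrightarrow> a n = 0)))
       \<and> (i > 12 \<longrightarrow> (\<forall>n. (n mod 3 \<in> {0, 2} \<longrightarrow> a n > 0) \<and>
                              (n mod 3 = 1 \<longrightarrow> a n < 0)))"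
proof -
  define C where "C = euler ^ 12 * inverse euler ^ i * triple (inverse euler ^ 3)"
  have "Abs_fps a * triple euler ^ i = euler ^ 9"
    by (rule qpoch_quotient_coeffs) (rule ha)
  note F = quotient_trisection[OF this, unfolded class_0_eq, folded C_def]
  have a0: "a (3 * n) = C $ n" for n
  proof -
    have "Abs_fps a $ (3 * n) = C $ n" by (subst F) (rule trisection_nth)
    thus ?thesis by simp
  qed
  have a1: "a (3 * n + 1) < 0" for n
  proof -
    have "Abs_fps a $ (3 * n + 1) = (- 9 * (theta_P ^ 2 * triple euler ^ 3 * inverse euler ^ i)) $ n"
      by (subst F) (rule trisection_nth)
    thus ?thesis using fps_pos_class_1[OF hi] by (simp add: fps_pos_def)
  qed
  have a2: "a (3 * n + 2) > 0" for n
  proof -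
    have "Abs_fps a $ (3 * n + 2) = (27 * (theta_P * triple euler ^ 6 * inverse euler ^ i)) $ n"
      by (subst F) (rule trisection_nth)
    thus ?thesis using fps_pos_class_2[OF hi] by (simp add: fps_pos_def)
  qed
  show ?thesis
  proof (intro conjI impI allI)
    fix n :: nat
    \<comment> \<open>Since \<open>n = 9 * (m div 3) + 3 * s + r\<close>, the digit \<open>r\<close>
      selects the class modulo 3 and \<open>s\<close> refines class 0 modulo 9.\<close>
    define m r s where "m = n div 3" and "r = n mod 3" and "s = m mod 3"
    have n: "3 * m + r = n" and m: "3 * (m div 3) + s = m" by (simp_all add: m_def r_def s_def)
    have mod_9: "n mod 9 = 3 * s + r"
      using mod_mult2_eq[of n 3 3] by (simp add: m_def r_def s_def)
    have r: "r = 0 \<or> r = 1 \<or> r = 2" and s: "s = 0 \<or> s = 1 \<or> s = 2"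
      unfolding r_def s_def by auto
    have r0: "a n = C $ m" if "r = 0" using a0[of m] n that by simp
    have r1: "a n < 0" if "r = 1" using a1[of m] n that by metis
    have r2: "a n > 0" if "r = 2" using a2[of m] n that by metis
    {
      assume i: "i = 11"
      have C: "C = triple (theta_sum alt (theta_exp 4 5) * inverse euler ^ 3)
        + fps_X * triple (- (theta_sum alt (theta_exp 7 2) * inverse euler ^ 3))
        + fps_X ^ 2 * triple (- (theta_sum alt (theta_exp 1 8) * inverse euler ^ 3))"
        using class_0_11 by (simp only: C_def i)
      have C0: "C $ (3 * k) > 0" and C1: "C $ (3 * k + 1) < 0" and C2: "C $ (3 * k + 2) < 0" for k
        using fps_pos_theta_quotient[of 4 5] fps_pos_theta_quotient[of 7 2] fps_pos_theta_quotient[of 1 8]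
        unfolding C trisection_nth by (simp_all add: fps_pos_def)
      have s0: "C $ m > 0" if "s = 0" using C0[of "m div 3"] m that by simp
      have s12: "C $ m < 0" if "s \<noteq> 0" using C1[of "m div 3"] C2[of "m div 3"] m that s by metis
      show "a n > 0" if "n mod 9 \<in> {0, 2, 5, 8}"
        using that r s r0 r2 s0 unfolding mod_9 by auto
      show "a n < 0" if "n mod 9 \<notin> {0, 2, 5, 8}"
        using that r s r0 r1 s12 unfolding mod_9 by auto
    }
    {
      assume i: "i = 12"
      have C: "C = triple (inverse euler ^ 3)"
        using class_0_12 by (simp only: C_def i)
      have "fps_pos (inverse euler ^ 3)" by (rule fps_pos_inverse_euler_power) simp
      hence s0: "C $ m > 0" if "s = 0"
        using that unfolding C s_def by (simp add: fps_nth_compose_X_power fps_pos_def dvd_eq_mod_eq_0)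
      have s12: "C $ m = 0" if "s \<noteq> 0"
        using that unfolding C s_def by (simp add: fps_nth_compose_X_power dvd_eq_mod_eq_0)
      show "a n > 0" if "n mod 9 \<in> {0, 2, 5, 8}"
        using that r s r0 r2 s0 unfolding mod_9 by auto
      show "a n < 0" if "n mod 9 \<in> {1, 4, 7}"
        using that r s r1 unfolding mod_9 by auto
      show "a n = 0" if "n mod 9 \<in> {3, 6}"
        using that r s r0 s12 unfolding mod_9 by auto
    }
    {
      assume i: "12 < i"
      show "a n > 0" if "n mod 3 \<in> {0, 2}"
        using that r0 r2 fps_pos_class_0[OF i] unfolding r_def[symmetric]
        by (auto simp: C_def fps_pos_def)
      show "a n < 0" if "n mod 3 = 1" using that r1 unfolding r_def by simp
    }
  qed
qed

end
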